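(* Let $F$ be a field containing a primitive $2$nd root of unity (i.e. $\operatorname{char}F\neq 2$), let $a\in F^\times\setminus F^{\times 2}$ and $E=F(\sqrt{a})$, a cyclic extension of degree $2$ with Galois group $G=\langle\sigma\rangle$. Let $n\in\mathbb{N}$ ($n\ge 1$). Then the sequence $$H^n(E,\mathbb{F}_2)\xrightarrow{\ \sigma-1\ }H^n(E,\mathbb{F}_2)\xrightarrow{\ \mathrm{cor}_{E/F}\ }H^n(F,\mathbb{F}_2)$$ is exact if and only if $$H^n(F,\mathbb{F}_2)=\mathrm{cor}_{E/F}\,H^n(E,\mathbb{F}_2)+(a)\cup H^{n-1}(F,\mathbb{F}_2).$$
   Context: For a field $K$, $H^n(K,\mathbb{F}_p)$ denotes Galois cohomology of the absolute Galois group of $K$ with trivial coefficients $\mathbb{F}_p$; $G=\mathrm{Gal}(E/F)$ acts on $H^n(E,\mathbb{F}_p)$, and $\mathrm{cor}_{E/F}$ is corestriction. For $b\in F^\times$, $(b)\in H^1(F,\mathbb{F}_p)$ is its Kummer class, and $\cup$ is the cup product. Exactness means $\ker(\mathrm{cor}_{E/F})=(\sigma-1)H^n(E,\mathbb{F}_p)$; this condition is called $(h90)_n$. The paper works throughout assuming the Bloch–Kato conjecture (the norm residue isomorphism $K_nK/p\cong H^n(K,\mu_p^{\otimes n})$ for fields $K$ of characteristic $\neq p$), now a theorem of Rost and Voevodsky. *)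

theory Defs
  imports
    "HOL-Analysis.Function_Topology"
    "HOL-Algebra.Bij"
    "HOL-Algebra.Coset"
    "HOL-Algebra.Generated_Groups"
    "HOL-Computational_Algebra.Polynomial"
    "HOL-Library.Z2"
begin

section \<open>Cohomology of topological groups with discrete trivial coefficients\<close>

text \<open>
  A topological group is given by a group \<open>G\<close> and a topology \<open>T\<close> on its carrier; the coefficients
  are a commutative ring \<open>'m\<close>, discrete and with trivial action.  We use homogeneous continuous
  cochains: an \<open>n\<close>-cochain is a continuous map from the \<open>n+1\<close>-fold product of \<open>G\<close> to \<open>'m\<close> that is
  invariant under simultaneous left translation.  Points of that product are
  extensional functions on \<open>{..n}\<close>, and cochains are normalised to be 0 off the product, so
  that equality of cochains is equality of functions.
\<close>

abbreviation points :: "('g, 'b) monoid_scheme \<Rightarrow> nat \<Rightarrow> (nat \<Rightarrow> 'g) set" where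
  "points G n \<equiv> {..n} \<rightarrow>\<^sub>E carrier G"

definition cochains ::
    "('g, 'b) monoid_scheme \<Rightarrow> 'g topology \<Rightarrow> nat \<Rightarrow> ((nat \<Rightarrow> 'g) \<Rightarrow> 'm::comm_ring_1) set" where
  "cochains G T n =
     {f. continuous_map (product_topology (\<lambda>_. T) {..n}) (discrete_topology UNIV) f \<and>
         (\<forall>g \<in> carrier G. \<forall>x \<in> points G n. f (\<lambda>i\<in>{..n}. g \<otimes>\<^bsub>G\<^esub> x i) = f x) \<and>
         (\<forall>x. x \<notin> points G n \<longrightarrow> f x = 0)}"

definition coboundary ::
    "('g, 'b) monoid_scheme \<Rightarrow> nat \<Rightarrow> ((nat \<Rightarrow> 'g) \<Rightarrow> 'm::comm_ring_1) \<Rightarrow> ((nat \<Rightarrow> 'g) \<Rightarrow> 'm)" where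
  "coboundary G n f x =
     (if x \<in> points G (Suc n)
      then \<Sum>i\<le>Suc n. (- 1) ^ i * f (\<lambda>j\<in>{..n}. x (if j < i then j else Suc j))
      else 0)"

definition cocycles ::
    "('g, 'b) monoid_scheme \<Rightarrow> 'g topology \<Rightarrow> nat \<Rightarrow> ((nat \<Rightarrow> 'g) \<Rightarrow> 'm::comm_ring_1) set" where
  "cocycles G T n = {f \<in> cochains G T n. coboundary G n f = (\<lambda>_. 0)}"

definition coboundaries ::
    "('g, 'b) monoid_scheme \<Rightarrow> 'g topology \<Rightarrow> nat \<Rightarrow> ((nat \<Rightarrow> 'g) \<Rightarrow> 'm::comm_ring_1) set" where
  "coboundaries G T n =
     (case n of 0 \<Rightarrow> {\<lambda>_. 0} | Suc m \<Rightarrow> coboundary G m ` cochains G T m)"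

definition cocycle_group ::
    "('g, 'b) monoid_scheme \<Rightarrow> 'g topology \<Rightarrow> nat \<Rightarrow> ((nat \<Rightarrow> 'g) \<Rightarrow> 'm::comm_ring_1) monoid" where
  "cocycle_group G T n =
     \<lparr>carrier = cocycles G T n, monoid.mult = (\<lambda>f g x. f x + g x), monoid.one = (\<lambda>_. 0)\<rparr>"

definition cohomology ::
    "('g, 'b) monoid_scheme \<Rightarrow> 'g topology \<Rightarrow> nat \<Rightarrow> ((nat \<Rightarrow> 'g) \<Rightarrow> 'm::comm_ring_1) set monoid" where
  "cohomology G T n = cocycle_group G T n Mod coboundaries G T n"

definition cohomology_class ::
    "('g, 'b) monoid_scheme \<Rightarrow> 'g topology \<Rightarrow> nat \<Rightarrow> ((nat \<Rightarrow> 'g) \<Rightarrow> 'm::comm_ring_1) \<Rightarrow>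
     ((nat \<Rightarrow> 'g) \<Rightarrow> 'm) set" where
  "cohomology_class G T n f = coboundaries G T n #>\<^bsub>cocycle_group G T n\<^esub> f"

text \<open>
  Operations on classes are induced by operations on cocycles: the resulting class does not
  depend on the representatives, and \<^const>\<open>the_elem\<close> extracts this common value.
\<close>

definition cup_cochain ::
    "('g, 'b) monoid_scheme \<Rightarrow> nat \<Rightarrow> nat \<Rightarrow> ((nat \<Rightarrow> 'g) \<Rightarrow> 'm::comm_ring_1) \<Rightarrow>
     ((nat \<Rightarrow> 'g) \<Rightarrow> 'm) \<Rightarrow> ((nat \<Rightarrow> 'g) \<Rightarrow> 'm)" where
  "cup_cochain G p q f g x =
     (if x \<in> points G (p + q)
      then f (\<lambda>i\<in>{..p}. x i) * g (\<lambda>i\<in>{..q}. x (p + i))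
      else 0)"

definition cup ::
    "('g, 'b) monoid_scheme \<Rightarrow> 'g topology \<Rightarrow> nat \<Rightarrow> nat \<Rightarrow> ((nat \<Rightarrow> 'g) \<Rightarrow> 'm::comm_ring_1) set \<Rightarrow>
     ((nat \<Rightarrow> 'g) \<Rightarrow> 'm) set \<Rightarrow> ((nat \<Rightarrow> 'g) \<Rightarrow> 'm) set" where
  "cup G T p q c d =
     the_elem ((\<lambda>(f, g). cohomology_class G T (p + q) (cup_cochain G p q f g)) ` (c \<times> d))"

text \<open>
  Corestriction from a subgroup \<open>H\<close> of finite index in \<open>G\<close>, by the usual cochain formula
  \[ (\mathrm{cor} f)(x_0,\dots,x_n) =
     \sum_{c \in H \backslash G} f(\bar c\, x_0\, \overline{c x_0}^{-1}, \dots,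
       \bar c\, x_n\, \overline{c x_n}^{-1}), \]
  where \<open>c \<mapsto> coset_rep c\<close> (the bar in the formula) is a system of representatives of the right
  cosets \<open>c = H g\<close>.  On cohomology the result is independent of that system.
\<close>

definition coset_rep :: "'g set \<Rightarrow> 'g" where
  "coset_rep c = (SOME g. g \<in> c)"

definition cores_cochain ::
    "('g, 'b) monoid_scheme \<Rightarrow> ('g, 'b) monoid_scheme \<Rightarrow> nat \<Rightarrow> ((nat \<Rightarrow> 'g) \<Rightarrow> 'm::comm_ring_1) \<Rightarrow>
     ((nat \<Rightarrow> 'g) \<Rightarrow> 'm)" where
  "cores_cochain H G n f x =
     (if x \<in> points G n
      then \<Sum>c \<in> rcosets\<^bsub>G\<^esub> (carrier H).
             f (\<lambda>i\<in>{..n}. coset_rep c \<otimes>\<^bsub>G\<^esub> x i \<otimes>\<^bsub>G\<^esub> inv\<^bsub>G\<^esub> (coset_rep (c #>\<^bsub>G\<^esub> x i)))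
      else 0)"

text \<open>Conjugation of cochains of a normal subgroup \<open>H\<close> by an element \<open>g\<close> of \<open>G\<close>.\<close>

definition conj_cochain ::
    "('g, 'b) monoid_scheme \<Rightarrow> ('g, 'b) monoid_scheme \<Rightarrow> nat \<Rightarrow> 'g \<Rightarrow> ((nat \<Rightarrow> 'g) \<Rightarrow> 'm::comm_ring_1) \<Rightarrow>
     ((nat \<Rightarrow> 'g) \<Rightarrow> 'm)" where
  "conj_cochain H G n g f x =
     (if x \<in> points H n then f (\<lambda>i\<in>{..n}. inv\<^bsub>G\<^esub> g \<otimes>\<^bsub>G\<^esub> x i \<otimes>\<^bsub>G\<^esub> g) else 0)"


section \<open>Fields and Galois groups\<close>

definition is_subfield :: "'s::field set \<Rightarrow> bool" where
  "is_subfield K \<longleftrightarrow>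
     0 \<in> K \<and> 1 \<in> K \<and>
     (\<forall>x\<in>K. \<forall>y\<in>K. x + y \<in> K \<and> x * y \<in> K) \<and>
     (\<forall>x\<in>K. - x \<in> K \<and> inverse x \<in> K)"

abbreviation separable_poly :: "'s::field poly \<Rightarrow> bool" where
  "separable_poly p \<equiv> coprime p (pderiv p)"

text \<open>
  The whole type \<open>'s\<close> is a separable closure of its subfield \<open>K\<close>: every element is a root of a
  separable polynomial over \<open>K\<close>, and \<open>'s\<close> is separably closed.
\<close>

definition separably_closes :: "'s::field set \<Rightarrow> bool" where
  "separably_closes K \<longleftrightarrow>
     is_subfield K \<and>
     (\<forall>x. \<exists>p. (\<forall>i. coeff p i \<in> K) \<and> separable_poly p \<and> poly p x = 0) \<and>
     (\<forall>p :: 's poly. degree p > 0 \<and> separable_poly p \<longrightarrow> (\<exists>x. poly p x = 0))"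

text \<open>A separable closure of \<open>F\<close> is also one of every intermediate field.\<close>

lemma separably_closes_intermediate:
  assumes "separably_closes F" "is_subfield K" "F \<subseteq> K"
  shows "separably_closes K"
  using assms unfolding separably_closes_def by blast

definition galois_group :: "'s::field set \<Rightarrow> 's set \<Rightarrow> ('s \<Rightarrow> 's) monoid" where
  "galois_group L K = (BijGroup L)
     \<lparr>carrier := {g \<in> Bij L. (\<forall>x\<in>L. \<forall>y\<in>L. g (x + y) = g x + g y \<and> g (x * y) = g x * g y) \<and>
                           (\<forall>x\<in>K. g x = x)}\<rparr>"

text \<open>
  The Krull topology is the topology of pointwise convergence on the discrete field \<open>L\<close>: a basic
  neighbourhood of \<open>g\<close> consists of the automorphisms that agree with \<open>g\<close> on a finite set \<open>A\<close>,
  i.e. it is the coset of \<open>g\<close> modulo \<open>Gal(L/K(A))\<close>.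
\<close>

definition krull_topology :: "'s::field set \<Rightarrow> 's set \<Rightarrow> ('s \<Rightarrow> 's) topology" where
  "krull_topology L K =
     subtopology (product_topology (\<lambda>_. discrete_topology L) L) (carrier (galois_group L K))"


section \<open>Galois cohomology with coefficients in the field with two elements\<close>

text \<open>
  Here \<open>'s\<close> plays the role of a fixed separable closure of all fields \<open>K\<close> considered, so
  the absolute Galois group of \<open>K\<close> is the group of all automorphisms of \<open>'s\<close> over \<open>K\<close>.
  The type \<^typ>\<open>bit\<close> is the field with two elements.
\<close>

abbreviation abs_galois :: "'s::field set \<Rightarrow> ('s \<Rightarrow> 's) monoid" where
  "abs_galois K \<equiv> galois_group UNIV K"

abbreviation abs_krull :: "'s::field set \<Rightarrow> ('s \<Rightarrow> 's) topology" where
  "abs_krull K \<equiv> krull_topology UNIV K"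

type_synonym 's galois_class = "((nat \<Rightarrow> 's \<Rightarrow> 's) \<Rightarrow> bit) set"

definition HF2 :: "'s::field set \<Rightarrow> nat \<Rightarrow> 's galois_class monoid" where
  "HF2 K n = cohomology (abs_galois K) (abs_krull K) n"

definition cores :: "'s::field set \<Rightarrow> 's set \<Rightarrow> nat \<Rightarrow> 's galois_class \<Rightarrow> 's galois_class" where
  "cores E F n c =
     the_elem ((\<lambda>f. cohomology_class (abs_galois F) (abs_krull F) n
                      (cores_cochain (abs_galois E) (abs_galois F) n f)) ` c)"

text \<open>
  An element \<open>\<sigma>\<close> of \<open>Gal(E/F)\<close> acts on the cohomology of \<open>E\<close> through conjugation by any lift of \<open>\<sigma>\<close>
  to the absolute Galois group of \<open>F\<close>; the action on classes is independent of the lift.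
\<close>

definition galois_lift :: "'s::field set \<Rightarrow> 's set \<Rightarrow> ('s \<Rightarrow> 's) \<Rightarrow> ('s \<Rightarrow> 's)" where
  "galois_lift E F \<sigma> = (SOME g. g \<in> carrier (abs_galois F) \<and> restrict g E = \<sigma>)"

definition galois_act ::
    "'s::field set \<Rightarrow> 's set \<Rightarrow> nat \<Rightarrow> ('s \<Rightarrow> 's) \<Rightarrow> 's galois_class \<Rightarrow> 's galois_class" where
  "galois_act E F n \<sigma> c =
     the_elem ((\<lambda>f. cohomology_class (abs_galois E) (abs_krull E) n
                      (conj_cochain (abs_galois E) (abs_galois F) n (galois_lift E F \<sigma>) f)) ` c)"

text \<open>
  The Kummer class of \<open>b\<close> is the class of the homomorphism \<open>g \<mapsto> g(\<surd>b)/\<surd>b\<close> into \<open>{1, -1}\<close>, the latter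
  being identified with the field of two elements by \<open>-1 \<mapsto> 1\<close>.  In homogeneous form the
  homomorphism is evaluated at \<open>x\<^sub>0\<^sup>-\<^sup>1 x\<^sub>1\<close>.  It does not depend on the choice of \<open>\<surd>b\<close>.
\<close>

definition kummer_hom :: "'s::field \<Rightarrow> ('s \<Rightarrow> 's) \<Rightarrow> bit" where
  "kummer_hom b g = (let \<beta> = (SOME \<beta>. \<beta>\<^sup>2 = b) in if g \<beta> / \<beta> = 1 then 0 else 1)"

definition kummer_class :: "'s::field set \<Rightarrow> 's \<Rightarrow> 's galois_class" where
  "kummer_class K b =
     cohomology_class (abs_galois K) (abs_krull K) 1
       (\<lambda>x. if x \<in> points (abs_galois K) 1
            then kummer_hom b (inv\<^bsub>abs_galois K\<^esub> (x 0) \<otimes>\<^bsub>abs_galois K\<^esub> x 1)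
            else 0)"

definition cup_HF2 ::
    "'s::field set \<Rightarrow> nat \<Rightarrow> nat \<Rightarrow> 's galois_class \<Rightarrow> 's galois_class \<Rightarrow> 's galois_class" where
  "cup_HF2 K p q = cup (abs_galois K) (abs_krull K) p q"

end

(* Let G be the absolute Galois group of F and H that of E, an open
   subgroup of index 2. Functions on the (n+1)-fold product of G that are only H-invariant form a
   complex I that computes the cohomology of H (Shapiro), and f + tau f, for tau in G - H, is the
   norm of a short exact sequence 0 -> C(G) -> I -> C(G) -> 0. Since 1_{x_0 not in H} f has norm f
   and its coboundary is (a) cup f when f is a cocycle, the long exact sequence reads
     H^{n-1}(F) -> H^n(F) -> H^n(E) -> H^n(F)
   with maps (a) cup, res, cor. Moreover res cor = 1 + sigma. Hence ker cor = im res, the image of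
   sigma - 1 is im (res cor), and the two agree iff H^n(F) = im cor + ker res, where
   ker res = (a) cup H^{n-1}(F). *)

theory Submission
  imports
    Defs
    "HOL-Analysis.Product_Topology"
    "HOL-Library.Function_Algebras"
begin

text \<open>The long exact sequence is never formed. Exactness is used at two places only, and each
  is a chase with explicit cochains in which the section 1_{x_0 not in H} f supplies the preimages
  under the norm. The obstacle is Shapiro's isomorphism: restriction to H, and its inverse by
  precomposition with an H-equivariant map from G to H, compose to the identity only up to homotopy.
  One prism operator, for two maps with the same equivariance, supplies these homotopies and also
  the one that turns res cor into 1 + sigma. Coefficients modulo 2 remove the signs from
  coboundaries and prisms, make sigma - 1 equal to sigma + 1, and turn a vanishing norm into
  invariance under tau. On the field side, what has to be constructed is an automorphism of the
  separable closure that moves sqrt(a), so that H is a proper subgroup; the same extension argument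
  yields the lift of sigma through which sigma acts on cohomology.\<close>

section \<open>Homogeneous cochains modulo 2\<close>

\<comment> \<open>These simp rules would turn sums and products in the field \<^typ>\<open>bit\<close> into bit operations.\<close>
declare add_bit_eq_xor [simp del] mult_bit_eq_and [simp del]

lemma bit_add_self [simp]: "(x::bit) + x = 0"
  by (cases x) auto

lemma bit_add_self_left [simp]: "(x::bit) + (x + y) = y"
  by (simp flip: add.assoc)

lemma bit_fun_add_self [simp]: "(f::'a \<Rightarrow> bit) + f = 0"
  by (simp add: fun_eq_iff)

lemma bit_fun_add_self_left [simp]: "(f::'a \<Rightarrow> bit) + (f + g) = g"
  by (simp add: fun_eq_iff)

lemma sum_fun_apply [simp]: "sum f A x = (\<Sum>a\<in>A. f a x)"
  for f :: "'a \<Rightarrow> 'b \<Rightarrow> 'c::comm_monoid_add"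
  by (induction A rule: infinite_finite_induct) auto

text \<open>A product of two discrete spaces is discrete, so the pair (f, g) is continuous into a
  discrete space, on which every \<open>h\<close> is continuous.\<close>

lemma continuous_map_discrete_binop:
  fixes f :: "'a \<Rightarrow> 'b" and g :: "'a \<Rightarrow> 'c"
  assumes "continuous_map X (discrete_topology UNIV) f" "continuous_map X (discrete_topology UNIV) g"
  shows "continuous_map X (discrete_topology UNIV) (\<lambda>x. h (f x) (g x))"
proof -
  have "continuous_map X (discrete_topology UNIV) (\<lambda>x. (f x, g x))"
    using assms prod_topology_discrete_topology[of "UNIV :: 'b set" "UNIV :: 'c set"]
    by (simp add: continuous_map_paired)
  from continuous_map_compose[OF this, of "discrete_topology UNIV" "\<lambda>(u, v). h u v"]
  show ?thesis by (simp add: comp_def)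
qed

lemma continuous_map_points:
  assumes "\<And>i. i \<le> m \<Longrightarrow> k i \<le> n" "\<And>i. i \<le> m \<Longrightarrow> continuous_map T' T (r i)"
  shows "continuous_map (product_topology (\<lambda>_. T') {..n}) (product_topology (\<lambda>_. T) {..m})
     (\<lambda>x. \<lambda>i\<in>{..m}. r i (x (k i)))"
proof (rule continuous_map_coordinatewise_then_product)
  fix i assume "i \<in> {..m}"
  then have *: "i \<le> m" by simp
  have "continuous_map (product_topology (\<lambda>_. T') {..n}) T' (\<lambda>x. x (k i))"
    by (rule continuous_map_product_coordinates) (use assms(1)[OF *] in auto)
  from continuous_map_compose[OF this assms(2)[OF *]] *
  show "continuous_map (product_topology (\<lambda>_. T') {..n}) T (\<lambda>x. (\<lambda>i\<in>{..m}. r i (x (k i))) i)"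
    by (simp add: comp_def)
qed auto


text \<open>The set \<open>S\<close> separates the points of the product from the translations that
  must fix the cochain. With \<open>S\<close> all of G these are the cochains of G; with
  \<open>S\<close> a subgroup H they form the complex I that computes the cohomology of H by
  functions on G.\<close>

definition invariant_cochains ::
    "('g, 'b) monoid_scheme \<Rightarrow> 'g topology \<Rightarrow> 'g set \<Rightarrow> nat \<Rightarrow> ((nat \<Rightarrow> 'g) \<Rightarrow> bit) set" where
  "invariant_cochains G T S n =
     {f. continuous_map (product_topology (\<lambda>_. T) {..n}) (discrete_topology UNIV) f \<and>
         (\<forall>g \<in> S. \<forall>x \<in> points G n. f (\<lambda>i\<in>{..n}. g \<otimes>\<^bsub>G\<^esub> x i) = f x) \<and>
         (\<forall>x. x \<notin> points G n \<longrightarrow> f x = 0)}"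

lemma cochains_eq_invariant_cochains: "cochains G T n = invariant_cochains G T (carrier G) n"
  by (simp add: cochains_def invariant_cochains_def)

definition invariant_coboundaries ::
    "('g, 'b) monoid_scheme \<Rightarrow> 'g topology \<Rightarrow> 'g set \<Rightarrow> nat \<Rightarrow> ((nat \<Rightarrow> 'g) \<Rightarrow> bit) set" where
  "invariant_coboundaries G T S n =
     (case n of 0 \<Rightarrow> {0} | Suc m \<Rightarrow> coboundary G m ` invariant_cochains G T S m)"

lemma coboundaries_eq_invariant_coboundaries:
  "coboundaries G T n = invariant_coboundaries G T (carrier G) n"
  by (auto simp: coboundaries_def invariant_coboundaries_def cochains_eq_invariant_cochains
      zero_fun_def split: nat.split)

lemma invariant_cochains_off: "f \<in> invariant_cochains G T S n \<Longrightarrow> x \<notin> points G n \<Longrightarrow> f x = 0"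
  by (simp add: invariant_cochains_def)

lemma invariant_cochains_zero [simp]: "0 \<in> invariant_cochains G T S n"
  by (simp add: invariant_cochains_def zero_fun_def)

lemma invariant_cochains_add [intro]:
  assumes "f \<in> invariant_cochains G T S n" "g \<in> invariant_cochains G T S n"
  shows "f + g \<in> invariant_cochains G T S n"
  using assms continuous_map_discrete_binop[of _ f g "(+)"]
  by (auto simp: invariant_cochains_def plus_fun_def)

lemma invariant_cochains_sum:
  "(\<And>i. i \<in> I \<Longrightarrow> f i \<in> invariant_cochains G T S n) \<Longrightarrow> sum f I \<in> invariant_cochains G T S n"
  by (induction I rule: infinite_finite_induct) auto

text \<open>The cutoff restores the normalisation to 0 off the product, whatever \<phi> does
  there.\<close>

definition pullback ::
    "('g, 'b) monoid_scheme \<Rightarrow> nat \<Rightarrow> ((nat \<Rightarrow> 'g) \<Rightarrow> (nat \<Rightarrow> 'h)) \<Rightarrow> ((nat \<Rightarrow> 'h) \<Rightarrow> bit) \<Rightarrow>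
     ((nat \<Rightarrow> 'g) \<Rightarrow> bit)" where
  "pullback G n \<phi> f x = (if x \<in> points G n then f (\<phi> x) else 0)"

lemma pullback_add: "pullback G n \<phi> (f + g) = pullback G n \<phi> f + pullback G n \<phi> g"
  by (auto simp: pullback_def)

lemma pullback_zero [simp]: "pullback G n \<phi> 0 = 0"
  by (auto simp: pullback_def)

text \<open>The substitutions used below all have this shape: \<open>k\<close> omits or repeats
  coordinates (faces, prisms), and \<open>r\<close> moves each one (translation, conjugation, the
  map from G to H). The twist \<theta> is there because conjugation and left translation by t turn
  translation by g into translation by a conjugate of g.\<close>

lemma pullback_invariant:
  assumes f: "f \<in> invariant_cochains G T S m"
    and T: "topspace T = carrier G" "topspace T' = carrier G'"
    and G': "group G'" "S' \<subseteq> carrier G'"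
    and k: "\<And>i. i \<le> m \<Longrightarrow> k i \<le> n"
    and r: "\<And>i. i \<le> m \<Longrightarrow> continuous_map T' T (r i)"
    and \<theta>: "\<And>g. g \<in> S' \<Longrightarrow> \<theta> g \<in> S"
    and eq: "\<And>i g x. i \<le> m \<Longrightarrow> g \<in> S' \<Longrightarrow> x \<in> carrier G' \<Longrightarrow> r i (g \<otimes>\<^bsub>G'\<^esub> x) = \<theta> g \<otimes>\<^bsub>G\<^esub> r i x"
  shows "pullback G' n (\<lambda>x. \<lambda>i\<in>{..m}. r i (x (k i))) f \<in> invariant_cochains G' T' S' n"
    (is "pullback G' n ?\<phi> f \<in> _")
proof -
  have cont: "continuous_map (product_topology (\<lambda>_. T') {..n}) (discrete_topology UNIV) (f \<circ> ?\<phi>)"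
    by (rule continuous_map_compose[OF continuous_map_points])
      (use f k r in \<open>auto simp: invariant_cochains_def\<close>)
  have cont': "continuous_map (product_topology (\<lambda>_. T') {..n}) (discrete_topology UNIV)
      (pullback G' n ?\<phi> f)"
    by (rule continuous_map_eq[OF cont]) (simp add: pullback_def T)
  have rmem: "r i y \<in> carrier G" if "i \<le> m" "y \<in> carrier G'" for i y
    using continuous_map_image_subset_topspace[OF r[OF that(1)]] that(2) by (auto simp: T)
  have "pullback G' n ?\<phi> f (\<lambda>i\<in>{..n}. g \<otimes>\<^bsub>G'\<^esub> x i) = pullback G' n ?\<phi> f x"
    if g: "g \<in> S'" and x: "x \<in> points G' n" for g x
  proof -
    have xi: "x i \<in> carrier G'" if "i \<le> n" for i using x that by auto
    have gx: "(\<lambda>i\<in>{..n}. g \<otimes>\<^bsub>G'\<^esub> x i) \<in> points G' n"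
      using G' g xi by (auto intro!: monoid.m_closed group.is_monoid)
    have "?\<phi> (\<lambda>i\<in>{..n}. g \<otimes>\<^bsub>G'\<^esub> x i) = (\<lambda>i\<in>{..m}. \<theta> g \<otimes>\<^bsub>G\<^esub> ?\<phi> x i)"
      using k eq g xi by (auto simp: restrict_def fun_eq_iff)
    moreover have "?\<phi> x \<in> points G m" using rmem xi k by auto
    moreover have "f (\<lambda>i\<in>{..m}. h \<otimes>\<^bsub>G\<^esub> y i) = f y" if "h \<in> S" "y \<in> points G m" for h y
      using f that unfolding invariant_cochains_def by blast
    ultimately have "f (?\<phi> (\<lambda>i\<in>{..n}. g \<otimes>\<^bsub>G'\<^esub> x i)) = f (?\<phi> x)"
      using \<theta>[OF g] by presburger
    with gx x show ?thesis unfolding pullback_def by (simp only: if_True)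
  qed
  with cont' show ?thesis by (simp add: invariant_cochains_def pullback_def)
qed

section \<open>Faces, coboundaries and the prism homotopy\<close>

definition face :: "nat \<Rightarrow> nat \<Rightarrow> (nat \<Rightarrow> 'g) \<Rightarrow> (nat \<Rightarrow> 'g)" where
  "face n i x = (\<lambda>j\<in>{..n}. x (if j < i then j else Suc j))"

lemma face_points: "x \<in> points G (Suc n) \<Longrightarrow> face n i x \<in> points G n"
  by (auto simp: face_def)

lemma coboundary_eq: "coboundary G n f = (\<Sum>i\<le>Suc n. pullback G (Suc n) (face n i) f)"
  for f :: "(nat \<Rightarrow> 'g) \<Rightarrow> bit"
  by (auto simp: fun_eq_iff coboundary_def pullback_def face_def)

lemma coboundary_apply:
  "x \<in> points G (Suc n) \<Longrightarrow> coboundary G n f x = (\<Sum>i\<le>Suc n. f (face n i x))"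
  for f :: "(nat \<Rightarrow> 'g) \<Rightarrow> bit"
  by (simp add: coboundary_def face_def)

lemma coboundary_add: "coboundary G n (f + g) = coboundary G n f + coboundary G n g"
  for f :: "(nat \<Rightarrow> 'g) \<Rightarrow> bit"
  by (simp add: coboundary_eq pullback_add sum.distrib del: sum.atMost_Suc)

lemma coboundary_zero [simp]: "coboundary G n 0 = (0 :: (nat \<Rightarrow> 'g) \<Rightarrow> bit)"
  by (simp add: coboundary_eq)

lemma coboundary_invariant:
  assumes "f \<in> invariant_cochains G T S n" "topspace T = carrier G" "group G" "S \<subseteq> carrier G"
  shows "coboundary G n f \<in> invariant_cochains G T S (Suc n)"
  unfolding coboundary_eq face_def
  by (rule invariant_cochains_sum, rule pullback_invariant[where r="\<lambda>_ x. x" and \<theta>="\<lambda>x. x"])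
    (use assms in auto)

text \<open>The terms with i < j are matched with the remaining ones by (j, i) -> (i, j - 1).
  Matched terms are equal, and equal terms add up to 0 in \<open>bit\<close>.\<close>

lemma sum_simplicial_cancel:
  fixes A :: "nat \<Rightarrow> nat \<Rightarrow> bit"
  assumes "\<And>i j. i < j \<Longrightarrow> j \<le> Suc N \<Longrightarrow> A j i = A i (j - 1)"
  shows "(\<Sum>j\<le>Suc N. \<Sum>i\<le>N. A j i) = 0"
proof -
  let ?U = "{p \<in> {..Suc N} \<times> {..N}. snd p < fst p}" and ?L = "{p \<in> {..Suc N} \<times> {..N}. \<not> snd p < fst p}"
  have "(\<Sum>j\<le>Suc N. \<Sum>i\<le>N. A j i) = (\<Sum>p\<in>{..Suc N} \<times> {..N}. A (fst p) (snd p))"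
    by (simp add: sum.cartesian_product case_prod_unfold)
  also have "\<dots> = (\<Sum>p\<in>?U. A (fst p) (snd p)) + (\<Sum>p\<in>?L. A (fst p) (snd p))"
    by (subst sum.union_disjoint[symmetric]) (auto intro: sum.cong)
  also have "(\<Sum>p\<in>?U. A (fst p) (snd p)) = (\<Sum>p\<in>?L. A (fst p) (snd p))"
    by (rule sum.reindex_bij_witness[where i="\<lambda>(j, i). (Suc i, j)" and j="\<lambda>(j, i). (i, j - 1)"])
      (auto simp: assms)
  finally show ?thesis by simp
qed

lemma face_face:
  assumes "i < j" "j \<le> Suc (Suc n)"
  shows "face n i (face (Suc n) j x) = face n (j - 1) (face (Suc n) i x)"
  using assms by (auto simp: face_def restrict_def fun_eq_iff)

lemma coboundary_coboundary [simp]: "coboundary G (Suc n) (coboundary G n f) = 0"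
  for f :: "(nat \<Rightarrow> 'g) \<Rightarrow> bit"
proof
  fix x
  show "coboundary G (Suc n) (coboundary G n f) x = 0 x"
  proof (cases "x \<in> points G (Suc (Suc n))")
    case True
    have "coboundary G (Suc n) (coboundary G n f) x
        = (\<Sum>j\<le>Suc (Suc n). \<Sum>i\<le>Suc n. f (face n i (face (Suc n) j x)))"
      by (simp add: coboundary_apply[OF True] coboundary_apply face_points[OF True]
          del: sum.atMost_Suc)
    also have "\<dots> = 0"
      by (rule sum_simplicial_cancel) (simp add: face_face)
    finally show ?thesis by simp
  qed (simp add: coboundary_def)
qed

text \<open>The combinatorics of the prism operator: \<open>A i j\<close> stands for the j-th face
  of the i-th simplex of a prism, \<open>B j i\<close> for the i-th simplex of the prism over the
  j-th face. Off the two diagonals the terms of A are those of B. On the diagonals neighbouring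
  simplices share a face \<open>m i\<close>, so each inner face occurs twice and only the two ends
  survive.\<close>

lemma sum_prism_cancel:
  fixes A B :: "nat \<Rightarrow> nat \<Rightarrow> bit"
  assumes lt: "\<And>i j. j < i \<Longrightarrow> i \<le> Suc n \<Longrightarrow> A i j = B j (i - 1)"
    and gt: "\<And>i j. Suc i < j \<Longrightarrow> j \<le> Suc (Suc n) \<Longrightarrow> A i j = B (j - 1) i"
    and diag: "\<And>i. i \<le> Suc n \<Longrightarrow> A i i = m i" "\<And>i. i \<le> Suc n \<Longrightarrow> A i (Suc i) = m (Suc i)"
  shows "(\<Sum>i\<le>Suc n. \<Sum>j\<le>Suc (Suc n). A i j)
    = (\<Sum>j\<le>Suc n. \<Sum>i\<le>n. B j i) + (m 0 + m (Suc (Suc n)))"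
proof -
  let ?X = "{..Suc n} \<times> {..Suc (Suc n)}" and ?Y = "{..Suc n} \<times> {..n}"
  let ?f = "\<lambda>p. A (fst p) (snd p)" and ?g = "\<lambda>p. B (fst p) (snd p)"
  have "(\<Sum>i\<le>Suc n. \<Sum>j\<le>Suc (Suc n). A i j) = sum ?f ?X"
    by (simp add: sum.cartesian_product case_prod_unfold del: sum.atMost_Suc)
  also have "?X = {p\<in>?X. snd p < fst p} \<union> ({p\<in>?X. Suc (fst p) < snd p} \<union>
      ({p\<in>?X. snd p = fst p} \<union> {p\<in>?X. snd p = Suc (fst p)}))"
    by auto
  also have "sum ?f \<dots> = sum ?f {p\<in>?X. snd p < fst p} + (sum ?f {p\<in>?X. Suc (fst p) < snd p} +
      (sum ?f {p\<in>?X. snd p = fst p} + sum ?f {p\<in>?X. snd p = Suc (fst p)}))"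
    by (subst sum.union_disjoint, simp, simp, force)+ simp
  also have "sum ?f {p\<in>?X. snd p < fst p} = sum ?g {p\<in>?Y. \<not> snd p < fst p}"
    by (rule sum.reindex_bij_witness[where i="\<lambda>(j, i). (Suc i, j)" and j="\<lambda>(i, j). (j, i - 1)"])
      (auto simp: lt)
  also have "sum ?f {p\<in>?X. Suc (fst p) < snd p} = sum ?g {p\<in>?Y. snd p < fst p}"
    by (rule sum.reindex_bij_witness[where i="\<lambda>(j, i). (i, Suc j)" and j="\<lambda>(i, j). (j - 1, i)"])
      (auto simp: gt)
  also have "sum ?f {p\<in>?X. snd p = fst p} = (\<Sum>i\<le>Suc n. m i)"
    by (rule sum.reindex_bij_witness[where i="\<lambda>i. (i, i)" and j=fst]) (auto simp: diag)
  also have "sum ?f {p\<in>?X. snd p = Suc (fst p)} = (\<Sum>i\<le>Suc n. m (Suc i))"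
    by (rule sum.reindex_bij_witness[where i="\<lambda>i. (i, Suc i)" and j=fst]) (auto simp: diag)
  also have "(\<Sum>i\<le>Suc n. m i) + (\<Sum>i\<le>Suc n. m (Suc i)) = m 0 + m (Suc (Suc n))"
    by (induction n) (auto simp: ac_simps)
  also have "sum ?g {p\<in>?Y. \<not> snd p < fst p} + (sum ?g {p\<in>?Y. snd p < fst p} + (m 0 + m (Suc (Suc n))))
     = sum ?g ?Y + (m 0 + m (Suc (Suc n)))"
    by (subst add.assoc[symmetric], subst sum.union_disjoint[symmetric]) (auto intro!: sum.cong)
  also have "sum ?g ?Y = (\<Sum>j\<le>Suc n. \<Sum>i\<le>n. B j i)"
    by (simp add: sum.cartesian_product case_prod_unfold del: sum.atMost_Suc)
  finally show ?thesis .
qed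

text \<open>The point (r x_0, ..., r x_i, s x_i, ..., s x_n): the i-th simplex in the usual
  triangulation of a prism with ends \<open>r\<close> and \<open>s\<close>, in which x_i is used
  twice.\<close>

definition prism :: "('g \<Rightarrow> 'h) \<Rightarrow> ('g \<Rightarrow> 'h) \<Rightarrow> nat \<Rightarrow> nat \<Rightarrow> (nat \<Rightarrow> 'g) \<Rightarrow> (nat \<Rightarrow> 'h)" where
  "prism r s n i x =
     (\<lambda>j\<in>{..Suc n}. (if j \<le> i then r else s) (x (if j \<le> i then j else j - 1)))"

abbreviation pullback_map ::
    "('g, 'b) monoid_scheme \<Rightarrow> nat \<Rightarrow> ('g \<Rightarrow> 'h) \<Rightarrow> ((nat \<Rightarrow> 'h) \<Rightarrow> bit) \<Rightarrow> ((nat \<Rightarrow> 'g) \<Rightarrow> bit)" where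
  "pullback_map G n r \<equiv> pullback G n (\<lambda>x. \<lambda>i\<in>{..n}. r (x i))"

text \<open>Maps that are equivariant for the same \<theta> are chain homotopic. The common twist is
  what makes the mixed points of a prism transform as a whole, so that the prism sum of
  \<open>f\<close> is again an invariant cochain.\<close>

lemma pullback_map_homotopy:
  assumes f: "f \<in> invariant_cochains G T S n" "coboundary G n f = 0"
    and T: "topspace T = carrier G" "topspace T' = carrier G'"
    and G': "group G'" "S' \<subseteq> carrier G'"
    and r: "continuous_map T' T r" "continuous_map T' T s"
    and \<theta>: "\<And>g. g \<in> S' \<Longrightarrow> \<theta> g \<in> S"
    and eq: "\<And>g x. g \<in> S' \<Longrightarrow> x \<in> carrier G' \<Longrightarrow> r (g \<otimes>\<^bsub>G'\<^esub> x) = \<theta> g \<otimes>\<^bsub>G\<^esub> r x"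
      "\<And>g x. g \<in> S' \<Longrightarrow> x \<in> carrier G' \<Longrightarrow> s (g \<otimes>\<^bsub>G'\<^esub> x) = \<theta> g \<otimes>\<^bsub>G\<^esub> s x"
  shows "pullback_map G' n r f + pullback_map G' n s f \<in> invariant_coboundaries G' T' S' n"
proof -
  have rmem: "r y \<in> carrier G" "s y \<in> carrier G" if "y \<in> carrier G'" for y
    using r[THEN continuous_map_image_subset_topspace] that by (auto simp: T)
  have pr: "prism r s n i x \<in> points G (Suc n)" if "x \<in> points G' n" "i \<le> n" for x i
    using that by (auto simp: prism_def PiE_iff rmem)
  show ?thesis
  proof (cases n)
    \<comment> \<open>No cochains lie below degree 0, so the two pullbacks must agree exactly. This
      follows from the vanishing of the coboundary on the single edge (r x_0, s x_0).\<close>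
    case 0
    have "pullback_map G' 0 r f x = pullback_map G' 0 s f x" for x
    proof (cases "x \<in> points G' 0")
      case True
      have "face 0 0 (prism r s 0 0 x) = (\<lambda>i\<in>{..0}. s (x i))"
        "face 0 1 (prism r s 0 0 x) = (\<lambda>i\<in>{..0}. r (x i))"
        by (auto simp: face_def prism_def restrict_def fun_eq_iff)
      moreover have "coboundary G 0 f (prism r s 0 0 x) = 0" using f 0 by simp
      ultimately have "f (\<lambda>i\<in>{..0}. s (x i)) + f (\<lambda>i\<in>{..0}. r (x i)) = 0"
        using pr[of x 0] True 0 by (simp add: coboundary_apply)
      then show ?thesis
        by (simp add: pullback_def) (metis bit_add_self_left add_0_right)
    qed (simp add: pullback_def)
    then have "pullback_map G' 0 r f = pullback_map G' 0 s f" by blast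
    then show ?thesis using 0 by (simp add: invariant_coboundaries_def)
  next
    case (Suc m)
    define p where "p = (\<Sum>i\<le>m. pullback G' m (prism r s m i) f)"
    have "p \<in> invariant_cochains G' T' S' m"
      unfolding p_def prism_def
      by (rule invariant_cochains_sum,
          rule pullback_invariant[OF f(1) T G', unfolded Suc, where \<theta>=\<theta>])
        (auto simp: r \<theta> eq)
    moreover have "coboundary G' m p x = (pullback_map G' n r f + pullback_map G' n s f) x" for x
    proof (cases "x \<in> points G' n")
      case True
      let ?A = "\<lambda>i j. f (face n j (prism r s n i x))"
      let ?B = "\<lambda>j i. f (prism r s m i (face m j x))"
      \<comment> \<open>The face shared by the prism simplices i - 1 and i: r on the coordinates
        before i, s from i on. At the extremes it is the pure s point and the pure r point.\<close>
      let ?m = "\<lambda>i. f (\<lambda>j\<in>{..n}. if j < i then r (x j) else s (x j))"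
      have "0 = (\<Sum>i\<le>Suc m. coboundary G n f (prism r s n i x))" using f by simp
      also have "\<dots> = (\<Sum>i\<le>Suc m. \<Sum>j\<le>Suc (Suc m). ?A i j)"
        by (rule sum.cong) (auto simp: Suc coboundary_apply pr[OF True, unfolded Suc]
            simp del: sum.atMost_Suc)
      finally have A: "(\<Sum>i\<le>Suc m. \<Sum>j\<le>Suc (Suc m). ?A i j) = 0" by (rule sym)
      have AB: "(\<Sum>i\<le>Suc m. \<Sum>j\<le>Suc (Suc m). ?A i j)
          = (\<Sum>j\<le>Suc m. \<Sum>i\<le>m. ?B j i) + (?m 0 + ?m (Suc (Suc m)))"
      proof (rule sum_prism_cancel)
        fix i j assume "j < i" "i \<le> Suc m"
        then have "face n j (prism r s n i x) = prism r s m (i - 1) (face m j x)"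
          by (auto simp: Suc face_def prism_def restrict_def fun_eq_iff)
        then show "?A i j = ?B j (i - 1)" by simp
      next
        fix i j assume "Suc i < j" "j \<le> Suc (Suc m)"
        then have "face n j (prism r s n i x) = prism r s m i (face m (j - 1) x)"
          by (auto simp: Suc face_def prism_def restrict_def fun_eq_iff)
        then show "?A i j = ?B (j - 1) i" by simp
      next
        fix i assume "i \<le> Suc m"
        then have "face n i (prism r s n i x) = (\<lambda>j\<in>{..n}. if j < i then r (x j) else s (x j))"
          "face n (Suc i) (prism r s n i x) = (\<lambda>j\<in>{..n}. if j < Suc i then r (x j) else s (x j))"
          by (auto simp: Suc face_def prism_def restrict_def fun_eq_iff)
        then show "?A i i = ?m i" "?A i (Suc i) = ?m (Suc i)" by simp_all
      qed
      have m1: "?m (Suc (Suc m)) = f (\<lambda>j\<in>{..n}. r (x j))"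
        by (rule arg_cong[of _ _ f]) (auto simp: Suc restrict_def fun_eq_iff)
      have B: "(\<Sum>j\<le>Suc m. \<Sum>i\<le>m. ?B j i) = coboundary G' m p x"
        using True unfolding Suc
        by (auto simp: coboundary_apply p_def pullback_def face_points simp del: sum.atMost_Suc)
      have m0: "?m 0 = f (\<lambda>j\<in>{..n}. s (x j))"
        by (rule arg_cong[of _ _ f]) (auto simp: restrict_def fun_eq_iff)
      have *: "coboundary G' m p x + (f (\<lambda>j\<in>{..n}. s (x j)) + f (\<lambda>j\<in>{..n}. r (x j))) = 0"
        using A unfolding AB B m0 m1 .
      have "coboundary G' m p x = f (\<lambda>j\<in>{..n}. s (x j)) + f (\<lambda>j\<in>{..n}. r (x j))"
        using arg_cong[OF *, of "(+) (coboundary G' m p x)"] by (simp only: bit_add_self_left add_0_right)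
      then show ?thesis using True by (simp add: pullback_def add.commute)
    qed (simp add: coboundary_def pullback_def Suc)
    ultimately have "pullback_map G' n r f + pullback_map G' n s f
        \<in> coboundary G' m ` invariant_cochains G' T' S' m"
      by (intro image_eqI[of _ _ p]) (auto simp only: fun_eq_iff)
    then show ?thesis by (simp add: invariant_coboundaries_def Suc)
  qed
qed

section \<open>Open subgroups of index two\<close>

lemma pullback_map_cong:
  assumes "\<And>x. x \<in> carrier G \<Longrightarrow> r x = s x"
  shows "pullback_map G n r f = pullback_map G n s f"
proof
  fix x
  show "pullback_map G n r f x = pullback_map G n s f x"
  proof (cases "x \<in> points G n")
    case True
    then have "(\<lambda>i\<in>{..n}. r (x i)) = (\<lambda>i\<in>{..n}. s (x i))"
      using assms by (intro restrict_ext) auto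
    then show ?thesis by (simp add: pullback_def)
  qed (simp add: pullback_def)
qed

lemma pullback_map_comp:
  assumes "\<And>x. x \<in> carrier G' \<Longrightarrow> r x \<in> carrier G"
  shows "pullback_map G' n r (pullback_map G n s f) = pullback_map G' n (\<lambda>x. s (r x)) f"
proof
  fix x
  show "pullback_map G' n r (pullback_map G n s f) x = pullback_map G' n (\<lambda>x. s (r x)) f x"
  proof (cases "x \<in> points G' n")
    case True
    then have "(\<lambda>i\<in>{..n}. r (x i)) \<in> points G n" using assms by auto
    moreover have "(\<lambda>i\<in>{..n}. s ((\<lambda>i\<in>{..n}. r (x i)) i)) = (\<lambda>i\<in>{..n}. s (r (x i)))"
      by (intro restrict_ext) auto
    ultimately show ?thesis using True unfolding pullback_def by presburger
  qed (simp add: pullback_def)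
qed

lemma pullback_map_id:
  assumes "f \<in> invariant_cochains G T S n"
  shows "pullback_map G n (\<lambda>x. x) f = f"
  using invariant_cochains_off[OF assms]
  by (auto simp: pullback_def fun_eq_iff PiE_def extensional_restrict)

lemma coboundary_pullback_map:
  assumes "\<And>x. x \<in> carrier G' \<Longrightarrow> r x \<in> carrier G"
  shows "coboundary G' n (pullback_map G' n r f) = pullback_map G' (Suc n) r (coboundary G n f)"
proof
  fix x
  show "coboundary G' n (pullback_map G' n r f) x = pullback_map G' (Suc n) r (coboundary G n f) x"
  proof (cases "x \<in> points G' (Suc n)")
    case True
    have "(\<lambda>i\<in>{..Suc n}. r (x i)) \<in> points G (Suc n)" using assms True by auto
    moreover have "(\<lambda>j\<in>{..n}. r (face n i x j)) = face n i (\<lambda>i\<in>{..Suc n}. r (x i))" for i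
      by (auto simp: face_def restrict_def fun_eq_iff)
    ultimately show ?thesis
      using True unfolding pullback_def
      by (simp only: coboundary_apply face_points if_True)
  qed (simp add: pullback_def coboundary_def)
qed

lemma invariant_cochains_mono:
  "S \<subseteq> S' \<Longrightarrow> invariant_cochains G T S' n \<subseteq> invariant_cochains G T S n"
  by (auto simp: invariant_cochains_def)

lemma invariant_cochains_translate:
  "f \<in> invariant_cochains G T S n \<Longrightarrow> g \<in> S \<Longrightarrow> x \<in> points G n \<Longrightarrow>
    f (\<lambda>i\<in>{..n}. g \<otimes>\<^bsub>G\<^esub> x i) = f x"
  by (simp add: invariant_cochains_def)

text \<open>Index two is expressed by \<open>mult_mem_iff\<close>, which says that non-membership in
  H is a homomorphism to Z/2, together with \<open>proper\<close>, which makes it nontrivial. In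
  this form it is the Kummer character of the quadratic extension. Continuity is asked of
  translations, from which conjugations and the map from G to H are built.\<close>

locale open_index_two = group G for G (structure) +
  fixes T :: "'a topology" and H :: "'a set"
  assumes topspace: "topspace T = carrier G"
    and left_translation: "g \<in> carrier G \<Longrightarrow> continuous_map T T (\<lambda>x. g \<otimes> x)"
    and right_translation: "g \<in> carrier G \<Longrightarrow> continuous_map T T (\<lambda>x. x \<otimes> g)"
    and subgroup: "subgroup H G"
    and openin: "openin T H" "openin T (carrier G - H)"
    and mult_mem_iff: "\<lbrakk>g \<in> carrier G; h \<in> carrier G\<rbrakk> \<Longrightarrow> g \<otimes> h \<in> H \<longleftrightarrow> (g \<in> H \<longleftrightarrow> h \<in> H)"
    and proper: "H \<noteq> carrier G"
begin

abbreviation "GH \<equiv> G\<lparr>carrier := H\<rparr>"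
abbreviation "TH \<equiv> subtopology T H"

lemma H_subset: "H \<subseteq> carrier G"
  using subgroup by (rule subgroup.subset)

lemma H_closed [simp]: "g \<in> H \<Longrightarrow> g \<in> carrier G"
  using H_subset by blast

lemma group_GH: "group GH"
  by (rule subgroup.subgroup_is_group[OF subgroup is_group])

lemma topspace_TH: "topspace TH = H"
  using H_subset by (simp add: topspace Int_absorb1)

lemma inv_cancel_left:
  assumes "g \<in> carrier G" "x \<in> carrier G"
  shows "inv g \<otimes> (g \<otimes> x) = x" "g \<otimes> (inv g \<otimes> x) = x"
  using assms by (simp_all flip: m_assoc)

lemma inv_mem_iff [simp]: "g \<in> carrier G \<Longrightarrow> inv g \<in> H \<longleftrightarrow> g \<in> H"
  using subgroup.m_inv_closed[OF subgroup, of g] subgroup.m_inv_closed[OF subgroup, of "inv g"]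
  by auto

lemma conj_mem: "g \<in> carrier G \<Longrightarrow> h \<in> H \<Longrightarrow> g \<otimes> h \<otimes> inv g \<in> H" "g \<in> carrier G \<Longrightarrow> h \<in> H \<Longrightarrow> inv g \<otimes> h \<otimes> g \<in> H"
  by (simp_all add: mult_mem_iff)

lemma r_coset_H: "g \<in> carrier G \<Longrightarrow> H #> g = (if g \<in> H then H else carrier G - H)"
proof -
  assume g: "g \<in> carrier G"
  have "x \<in> H #> g \<longleftrightarrow> x \<in> carrier G \<and> x \<otimes> inv g \<in> H" for x
  proof
    assume "x \<in> H #> g"
    then show "x \<in> carrier G \<and> x \<otimes> inv g \<in> H" using g by (auto simp: r_coset_def m_assoc)
  next
    assume x: "x \<in> carrier G \<and> x \<otimes> inv g \<in> H"
    then have "x = (x \<otimes> inv g) \<otimes> g" using g by (simp add: m_assoc)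
    then show "x \<in> H #> g" using x unfolding r_coset_def by blast
  qed
  then have "x \<in> H #> g \<longleftrightarrow> x \<in> (if g \<in> H then H else carrier G - H)" for x
    using g by (cases "x \<in> carrier G") (auto simp: mult_mem_iff dest: H_closed)
  then show ?thesis by blast
qed

text \<open>The representative that the corestriction formula picks in the coset H. It can be any
  element of H, so it is carried along instead of being replaced by the identity.\<close>

definition u where "u = coset_rep H"
definition t where "t = coset_rep (carrier G - H)"

lemma u_mem [simp]: "u \<in> H"
  unfolding u_def coset_rep_def using subgroup.one_closed[OF subgroup] by (rule someI)

lemma t_mem: "t \<in> carrier G - H"
proof -
  have "\<exists>g. g \<in> carrier G - H" using proper H_subset by blast
  then show ?thesis unfolding t_def coset_rep_def by (rule someI_ex)
qed

lemma t_simps [simp]: "t \<in> carrier G" "t \<notin> H"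
  using t_mem by auto

lemma rcosets_H: "rcosets H = {H, carrier G - H}"
proof
  show "rcosets H \<subseteq> {H, carrier G - H}"
  proof
    fix c assume "c \<in> rcosets H"
    then obtain g where "g \<in> carrier G" "c = H #> g" unfolding RCOSETS_def by blast
    then show "c \<in> {H, carrier G - H}" by (simp add: r_coset_H)
  qed
  have "H #> u = H" "H #> t = carrier G - H" by (simp_all add: r_coset_H)
  then show "{H, carrier G - H} \<subseteq> rcosets H"
    using rcosetsI[OF H_subset, of u] rcosetsI[OF H_subset, of t] by simp
qed

text \<open>The H-part of g in the decomposition g = h c with c the chosen representative of H g. It
  commutes with left translation by H; on H itself it is right translation by \<open>inv u\<close>,
  hence only homotopic to the identity.\<close>

definition retract where "retract g = g \<otimes> inv (if g \<in> H then u else t)"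

lemma retract_mem: "g \<in> carrier G \<Longrightarrow> retract g \<in> H"
  by (auto simp: retract_def mult_mem_iff)

lemma retract_mult: "h \<in> H \<Longrightarrow> g \<in> carrier G \<Longrightarrow> retract (h \<otimes> g) = h \<otimes> retract g"
  by (auto simp: retract_def mult_mem_iff m_assoc)

text \<open>On each of the two open cosets the map is a right translation, so a preimage is the
  union of two open pieces.\<close>

lemma continuous_retract: "continuous_map T T retract"
proof -
  have "openin T {x \<in> topspace T. retract x \<in> U}" if "openin T U" for U
  proof -
    have *: "openin T {x \<in> topspace T. x \<otimes> g \<in> U}" if "g \<in> carrier G" for g
      using right_translation[OF that] \<open>openin T U\<close> by (rule openin_continuous_map_preimage)
    have "{x \<in> topspace T. retract x \<in> U} = (H \<inter> {x \<in> topspace T. x \<otimes> inv u \<in> U}) \<union>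
        ((carrier G - H) \<inter> {x \<in> topspace T. x \<otimes> inv t \<in> U})"
      by (auto simp: retract_def topspace)
    then show ?thesis using openin *[of "inv u"] *[of "inv t"] by auto
  qed
  then show ?thesis using retract_mem by (auto simp: continuous_map topspace)
qed

lemma continuous_retract_TH: "continuous_map T TH retract"
  using continuous_retract retract_mem by (auto simp: continuous_map_in_subtopology topspace)

lemma continuous_map_TH: "continuous_map T T r \<Longrightarrow> (\<And>x. x \<in> H \<Longrightarrow> r x \<in> H) \<Longrightarrow> continuous_map TH TH r"
  by (auto simp: continuous_map_in_subtopology continuous_map_from_subtopology topspace_TH)

section \<open>The complexes of G and H and the maps between them\<close>

abbreviation "CG n \<equiv> invariant_cochains G T (carrier G) n"
abbreviation "CI n \<equiv> invariant_cochains G T H n"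
abbreviation "CH n \<equiv> invariant_cochains GH TH H n"
abbreviation "BG n \<equiv> invariant_coboundaries G T (carrier G) n"
abbreviation "BH n \<equiv> invariant_coboundaries GH TH H n"
abbreviation "d \<equiv> coboundary G"
abbreviation "dH \<equiv> coboundary GH"

lemma CG_CI: "f \<in> CG n \<Longrightarrow> f \<in> CI n"
  using invariant_cochains_mono[OF H_subset] by blast

lemma d_CG: "f \<in> CG n \<Longrightarrow> d n f \<in> CG (Suc n)"
  by (rule coboundary_invariant) (auto simp: topspace)

lemma d_CI: "f \<in> CI n \<Longrightarrow> d n f \<in> CI (Suc n)"
  by (rule coboundary_invariant) (auto simp: topspace)

lemma dH_CH: "f \<in> CH n \<Longrightarrow> dH n f \<in> CH (Suc n)"
  by (rule coboundary_invariant) (auto simp: topspace_TH group_GH simp del: topspace_subtopology)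

text \<open>
  \<open>ind\<close> is the inverse of restriction up to homotopy in Shapiro's lemma, and \<open>half\<close> is a section
  of the norm \<open>nrm\<close> that fails to commute with coboundaries by the cup product with the Kummer class.
\<close>

definition ind where "ind n f = pullback_map G n retract f"
definition nrm where "nrm n f = f + pullback_map G n (\<lambda>x. t \<otimes> x) f"
definition res where "res n f = pullback_map GH n (\<lambda>x. x) f"
definition half where "half n f x = of_bool (x 0 \<notin> H) * (f x :: bit)"

lemma ind_CI: "f \<in> CH n \<Longrightarrow> ind n f \<in> CI n"
  unfolding ind_def
  by (rule pullback_invariant[where \<theta>="\<lambda>x. x" and T=TH and G=GH])
   (auto simp: topspace_TH topspace continuous_retract_TH retract_mult is_group simp del: topspace_subtopology)

lemma res_CH: "f \<in> CI n \<Longrightarrow> res n f \<in> CH n"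
  unfolding res_def
  by (rule pullback_invariant[where \<theta>="\<lambda>x. x" and T=T and G=G])
   (auto simp: topspace_TH topspace group_GH continuous_map_from_subtopology simp del: topspace_subtopology)

lemma d_ind: "d n (ind n f) = ind (Suc n) (dH n f)"
  unfolding ind_def by (rule coboundary_pullback_map) (simp add: retract_mem)

lemma dH_res: "dH n (res n f) = res (Suc n) (d n f)"
  unfolding res_def by (rule coboundary_pullback_map) simp

lemma d_nrm: "d n (nrm n f) = nrm (Suc n) (d n f)"
  unfolding nrm_def by (simp add: coboundary_add coboundary_pullback_map)

lemma ind_add: "ind n (f + g) = ind n f + ind n g"
  by (simp add: ind_def pullback_add)

lemma res_add: "res n (f + g) = res n f + res n g"
  by (simp add: res_def pullback_add)

lemma nrm_add: "nrm n (f + g) = nrm n f + nrm n g"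
  by (simp add: nrm_def pullback_add ac_simps)

lemma ind_zero [simp]: "ind n 0 = 0"
  by (simp add: ind_def)

lemma res_zero [simp]: "res n 0 = 0"
  by (simp add: res_def)

lemma nrm_zero [simp]: "nrm n 0 = 0"
  by (simp add: nrm_def)

lemma translate_points: "x \<in> points G n \<Longrightarrow> g \<in> carrier G \<Longrightarrow> (\<lambda>i\<in>{..n}. g \<otimes> x i) \<in> points G n"
  by auto

lemma translate_translate:
  assumes "x \<in> points G n" "g \<in> carrier G" "h \<in> carrier G"
  shows "(\<lambda>i\<in>{..n}. g \<otimes> (\<lambda>i\<in>{..n}. h \<otimes> x i) i) = (\<lambda>i\<in>{..n}. (g \<otimes> h) \<otimes> x i)"
  using assms by (intro restrict_ext) (auto simp: m_assoc PiE_iff)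

text \<open>Two elements outside H differ by a left factor in H, which \<open>f\<close> does not
  see. Hence the norm does not depend on the choice of \<open>t\<close>.\<close>

lemma nonmember_translate:
  assumes f: "f \<in> CI n" and x: "x \<in> points G n" and g: "g \<in> carrier G" "g \<notin> H"
  shows "f (\<lambda>i\<in>{..n}. g \<otimes> x i) = f (\<lambda>i\<in>{..n}. t \<otimes> x i)"
proof -
  have "f (\<lambda>i\<in>{..n}. (g \<otimes> inv t) \<otimes> (\<lambda>i\<in>{..n}. t \<otimes> x i) i) = f (\<lambda>i\<in>{..n}. t \<otimes> x i)"
    by (rule invariant_cochains_translate[OF f _ translate_points[OF x]]) (simp_all add: mult_mem_iff g)
  then show ?thesis
    unfolding translate_translate[OF x m_closed[OF g(1) inv_closed[OF t_simps(1)]] t_simps(1)]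
    using g by (simp add: m_assoc)
qed

text \<open>Translation by H fixes both summands, the second because t h = (t h inv t) t with the
  bracket in H. Translation by g outside H interchanges them, since t g lies in H.\<close>

lemma nrm_CG:
  assumes f: "f \<in> CI n" shows "nrm n f \<in> CG n"
proof -
  have "pullback_map G n (\<lambda>x. t \<otimes> x) f \<in> CI n"
    by (rule pullback_invariant[OF f, where \<theta>="\<lambda>h. t \<otimes> h \<otimes> inv t"])
      (auto simp: topspace left_translation mult_mem_iff m_assoc is_group inv_cancel_left)
  then have CI: "nrm n f \<in> CI n" unfolding nrm_def using f by auto
  have nrm: "nrm n f x = f x + f (\<lambda>i\<in>{..n}. t \<otimes> x i)" if "x \<in> points G n" for x
    using that by (simp add: nrm_def pullback_def)
  have "nrm n f (\<lambda>i\<in>{..n}. g \<otimes> x i) = nrm n f x" if g: "g \<in> carrier G" and x: "x \<in> points G n" for g x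
  proof (cases "g \<in> H")
    case True
    then show ?thesis using invariant_cochains_translate[OF CI] x by blast
  next
    case False
    have "f (\<lambda>i\<in>{..n}. (t \<otimes> g) \<otimes> x i) = f x"
      by (rule invariant_cochains_translate[OF f _ x]) (simp add: mult_mem_iff g False)
    then show ?thesis
      using translate_points[OF x g] translate_translate[OF x t_simps(1) g]
        nonmember_translate[OF f x g False]
      by (simp add: nrm x add.commute)
  qed
  with CI show ?thesis by (simp add: invariant_cochains_def)
qed

text \<open>Modulo 2 a vanishing norm says that translation by \<open>t\<close> fixes
  \<open>f\<close>, and with H this accounts for all of G. With \<open>nrm_CG_eq_zero\<close> and
  \<open>nrm_half\<close> this is the exactness of 0 -> C(G) -> I -> C(G) -> 0.\<close>

lemma nrm_kernel:
  assumes f: "f \<in> CI n" and "nrm n f = 0" shows "f \<in> CG n"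
proof -
  have t: "f (\<lambda>i\<in>{..n}. t \<otimes> x i) = f x" if "x \<in> points G n" for x
  proof -
    have "f x + f (\<lambda>i\<in>{..n}. t \<otimes> x i) = 0"
      using fun_cong[OF assms(2), of x] that by (simp add: nrm_def pullback_def)
    then show ?thesis by (metis bit_add_self_left add_0_right)
  qed
  have "f (\<lambda>i\<in>{..n}. g \<otimes> x i) = f x" if "g \<in> carrier G" "x \<in> points G n" for g x
    using that invariant_cochains_translate[OF f] t nonmember_translate[OF f] by metis
  then show ?thesis using f by (simp add: invariant_cochains_def)
qed

lemma nrm_CG_eq_zero: "f \<in> CG n \<Longrightarrow> nrm n f = 0"
proof
  fix x assume f: "f \<in> CG n"
  show "nrm n f x = 0 x"
    using invariant_cochains_translate[OF f t_simps(1), of x] invariant_cochains_off[OF f, of x]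
    by (simp add: nrm_def pullback_def)
qed

text \<open>The cutoff factor depends only on the coset of x_0: it is continuous because both cosets
  are open, and H-invariant because left translation by H preserves them.\<close>

lemma half_CI:
  assumes f: "f \<in> CI n" shows "half n f \<in> CI n"
proof -
  let ?X = "product_topology (\<lambda>_. T) {..n}"
  have e: "continuous_map T (discrete_topology UNIV) (\<lambda>g. of_bool (g \<notin> H) :: bit)"
  proof -
    have "{x \<in> topspace T. (of_bool (x \<notin> H) :: bit) \<in> U} =
      (if 0 \<in> U then H else {}) \<union> (if 1 \<in> U then carrier G - H else {})" for U
      by (auto simp: topspace)
    moreover have "openin T (carrier G)" using openin_topspace[of T] by (simp add: topspace)
    ultimately show ?thesis using openin by (auto simp: continuous_map intro!: openin_Un)
  qed
  have "continuous_map ?X T (\<lambda>x. x 0)"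
    by (rule continuous_map_product_coordinates) simp
  then have e': "continuous_map ?X (discrete_topology UNIV) (\<lambda>x. of_bool (x 0 \<notin> H) :: bit)"
    using continuous_map_compose[of ?X T "\<lambda>x. x 0", OF _ e] by (simp only: comp_def)
  have "continuous_map ?X (discrete_topology UNIV) f"
    using f by (simp add: invariant_cochains_def)
  with e' have "continuous_map ?X (discrete_topology UNIV) (half n f)"
    unfolding half_def[abs_def] by (rule continuous_map_discrete_binop)
  moreover have "half n f (\<lambda>i\<in>{..n}. g \<otimes> x i) = half n f x" if "g \<in> H" "x \<in> points G n" for g x
  proof -
    have "x 0 \<in> carrier G" using that by auto
    then show ?thesis
      using that invariant_cochains_translate[OF f that] by (simp add: half_def mult_mem_iff)
  qed
  ultimately show ?thesis
    using invariant_cochains_off[OF f] by (simp add: invariant_cochains_def half_def)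
qed

text \<open>Translation by \<open>t\<close> moves x_0 to the other coset, so exactly one of the two
  summands is cut off.\<close>

lemma nrm_half:
  assumes f: "f \<in> CG n" shows "nrm n (half n f) = f"
proof
  fix x
  show "nrm n (half n f) x = f x"
  proof (cases "x \<in> points G n")
    case True
    then have "x 0 \<in> carrier G" by auto
    then show ?thesis
      using True invariant_cochains_translate[OF f t_simps(1) True]
      by (simp add: nrm_def pullback_def half_def mult_mem_iff)
  qed (use invariant_cochains_off[OF f] in \<open>simp add: nrm_def pullback_def half_def\<close>)
qed

section \<open>The character of G with kernel H and the cup product with it\<close>

definition kummer_cocycle where "kummer_cocycle x = (if x \<in> points G 1 then of_bool (inv (x 0) \<otimes> x 1 \<notin> H) else (0::bit))"

definition cup_kummer where "cup_kummer n = cup_cochain G 1 n kummer_cocycle"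

text \<open>Only the 0-th face changes the leading coordinate, from x_0 to x_1. The cutoffs at x_0
  and x_1 differ there by the character evaluated on (x_0, x_1), and the 0-th face is the second
  factor of the cup product.\<close>

lemma d_half:
  "d n (half n f) = cup_kummer n f + half (Suc n) (d n f)"
proof
  fix x
  show "d n (half n f) x = (cup_kummer n f + half (Suc n) (d n f)) x"
  proof (cases "x \<in> points G (Suc n)")
    case True
    have x: "x 0 \<in> carrier G" "x (Suc 0) \<in> carrier G" using True by auto
    have f0: "face n 0 x = (\<lambda>i\<in>{..n}. x (Suc i))" by (simp add: face_def)
    have "(\<lambda>i\<in>{..1}. x i) \<in> points G 1" using True by auto
    then have "kummer_cocycle (\<lambda>i\<in>{..1}. x i) = of_bool (x 0 \<notin> H) + of_bool (x 1 \<notin> H)"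
      using x by (auto simp: kummer_cocycle_def mult_mem_iff)
    then have cup: "cup_kummer n f x = (of_bool (x 0 \<notin> H) + of_bool (x 1 \<notin> H)) * f (face n 0 x)"
      using True unfolding cup_kummer_def cup_cochain_def f0 by simp
    have "d n (half n f) x = (\<Sum>i\<le>Suc n. of_bool (face n i x 0 \<notin> H) * f (face n i x))"
      by (simp only: coboundary_apply[OF True] half_def)
    also have "\<dots> = of_bool (x 1 \<notin> H) * f (face n 0 x) +
        (\<Sum>i\<le>n. of_bool (x 0 \<notin> H) * f (face n (Suc i) x))"
      unfolding sum.atMost_Suc_shift by (simp add: face_def)
    also have "\<dots> = cup_kummer n f x + of_bool (x 0 \<notin> H) * (\<Sum>i\<le>Suc n. f (face n i x))"
      unfolding sum.atMost_Suc_shift cup by (simp add: algebra_simps sum_distrib_left)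
    finally show ?thesis
      by (simp only: coboundary_apply[OF True] half_def plus_fun_apply)
  qed (simp add: coboundary_def cup_kummer_def cup_cochain_def half_def)
qed

text \<open>With this form the formal properties of the cup product follow from d d = 0 and from the
  norm, without reference to the cup formula.\<close>

lemma cup_kummer_eq: "cup_kummer n f = d n (half n f) + half (Suc n) (d n f)"
  unfolding d_half by (simp add: add.assoc)

text \<open>Both summands of \<open>cup_kummer_eq\<close> have norm d f, so their sum has norm 0 and
  is G-invariant.\<close>

lemma cup_kummer_CG: "f \<in> CG n \<Longrightarrow> cup_kummer n f \<in> CG (Suc n)"
  by (rule nrm_kernel)
    (auto simp: cup_kummer_eq nrm_add nrm_half d_CG CG_CI simp flip: d_nrm intro!: d_CI half_CI)

lemma cup_kummer_add: "cup_kummer n (f + g) = cup_kummer n f + cup_kummer n g"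
  by (auto simp: cup_kummer_def cup_cochain_def fun_eq_iff algebra_simps)

lemma half_zero [simp]: "half n 0 = 0"
  by (auto simp: half_def)

lemma d_cup_kummer: "d n f = 0 \<Longrightarrow> d (Suc n) (cup_kummer n f) = 0"
  by (simp add: cup_kummer_eq)

lemma cup_kummer_coboundary: "cup_kummer (Suc n) (d n f) = d (Suc n) (cup_kummer n f)"
  by (simp add: cup_kummer_eq coboundary_add)

text \<open>The character is trivial on H, so this holds already for cochains.\<close>

lemma res_cup_kummer: "res (Suc n) (cup_kummer n f) = 0"
proof
  fix x
  show "res (Suc n) (cup_kummer n f) x = 0 x"
  proof (cases "x \<in> points GH (Suc n)")
    case True
    then have "x 0 \<in> H" "x (Suc 0) \<in> H" by auto
    then have "kummer_cocycle (\<lambda>i\<in>{..1}. (\<lambda>i\<in>{..Suc n}. x i) i) = 0"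
      by (simp add: kummer_cocycle_def mult_mem_iff)
    then have "cup_kummer n f (\<lambda>i\<in>{..Suc n}. x i) = 0"
      by (simp only: cup_kummer_def cup_cochain_def plus_1_eq_Suc mult_zero_left if_cancel)
    then show ?thesis by (simp only: res_def pullback_def zero_fun_apply if_cancel)
  qed (simp add: res_def pullback_def)
qed

text \<open>The sum has two terms. For the coset H the arguments are u times
  \<open>retract (x i)\<close>, and invariance of \<open>f\<close> removes the u. For the other
  coset they are exactly \<open>retract (t \<otimes> x i)\<close>, the translate by \<open>t\<close>
  in the norm.\<close>

lemma cores_cochain_eq:
  assumes f: "f \<in> CH n" shows "cores_cochain GH G n f = nrm n (ind n f)"
proof
  fix x
  show "cores_cochain GH G n f x = nrm n (ind n f) x"
  proof (cases "x \<in> points G n")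
    case True
    then have xi: "x i \<in> carrier G" if "i \<le> n" for i using that by auto
    have rr: "(\<lambda>i\<in>{..n}. retract (x i)) \<in> points GH n" using xi retract_mem by auto
    have "(\<lambda>i\<in>{..n}. coset_rep H \<otimes> x i \<otimes> inv (coset_rep (H #> x i)))
        = (\<lambda>i\<in>{..n}. u \<otimes>\<^bsub>GH\<^esub> (\<lambda>i\<in>{..n}. retract (x i)) i)"
      by (intro restrict_ext)
        (auto simp: xi r_coset_H retract_def m_assoc simp flip: u_def t_def)
    then have 1: "f (\<lambda>i\<in>{..n}. coset_rep H \<otimes> x i \<otimes> inv (coset_rep (H #> x i)))
        = f (\<lambda>i\<in>{..n}. retract (x i))"
      using invariant_cochains_translate[OF f u_mem rr] by presburger
    have D: "carrier G - H = H #> t" by (simp add: r_coset_H)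
    have 2: "(\<lambda>i\<in>{..n}. coset_rep (carrier G - H) \<otimes> x i \<otimes> inv (coset_rep ((carrier G - H) #> x i)))
        = (\<lambda>i\<in>{..n}. retract ((\<lambda>i\<in>{..n}. t \<otimes> x i) i))"
    proof (intro restrict_ext)
      fix i assume i: "i \<in> {..n}"
      then have "(carrier G - H) #> x i = H #> (t \<otimes> x i)"
        unfolding D using xi H_subset by (intro coset_mult_assoc) auto
      then show "coset_rep (carrier G - H) \<otimes> x i \<otimes> inv (coset_rep ((carrier G - H) #> x i))
          = retract ((\<lambda>i\<in>{..n}. t \<otimes> x i) i)"
        using i by (auto simp: xi r_coset_H retract_def simp flip: u_def t_def)
    qed
    have "H \<noteq> carrier G - H" using u_mem by blast
    then have "cores_cochain GH G n f x = f (\<lambda>i\<in>{..n}. retract (x i))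
        + f (\<lambda>i\<in>{..n}. retract ((\<lambda>i\<in>{..n}. t \<otimes> x i) i))"
      using True 1 2 by (simp add: cores_cochain_def rcosets_H)
    then show ?thesis
      using True translate_points[OF True t_simps(1)]
      by (simp add: nrm_def ind_def pullback_def)
  qed (simp add: cores_cochain_def nrm_def ind_def pullback_def)
qed

end

lemma invariant_coboundaries_Suc:
  "invariant_coboundaries G T S (Suc m) = coboundary G m ` invariant_cochains G T S m"
  by (simp add: invariant_coboundaries_def)

lemma invariant_coboundaries_add:
  "f \<in> invariant_coboundaries G T S n \<Longrightarrow> g \<in> invariant_coboundaries G T S n \<Longrightarrow>
    f + g \<in> invariant_coboundaries G T S n"
  by (cases n) (auto simp: invariant_coboundaries_def simp flip: coboundary_add)

lemma invariant_coboundaries_zero [simp]: "0 \<in> invariant_coboundaries G T S n"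
proof (cases n)
  case (Suc m)
  from imageI[OF invariant_cochains_zero, of "coboundary G m" G T S m] show ?thesis by (simp add: Suc invariant_coboundaries_def)
qed (simp add: invariant_coboundaries_def)

section \<open>Restriction, corestriction and conjugation up to coboundaries\<close>

context open_index_two
begin

lemma conj_cochain_eq: "conj_cochain GH G n g f = pullback_map GH n (\<lambda>x. inv g \<otimes> x \<otimes> g) f"
  by (auto simp: conj_cochain_def pullback_def)

lemma continuous_conj: "g \<in> carrier G \<Longrightarrow> continuous_map T T (\<lambda>x. inv g \<otimes> x \<otimes> g)"
  using continuous_map_compose[OF left_translation right_translation, of "inv g" g]
  by (simp add: comp_def)

lemma conj_CH:
  assumes "g \<in> carrier G" "f \<in> CH n"
  shows "conj_cochain GH G n g f \<in> CH n"
  unfolding conj_cochain_eq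
  by (rule pullback_invariant[OF assms(2), where \<theta>="\<lambda>h. inv g \<otimes> h \<otimes> g" and T'=TH])
    (use assms in \<open>auto simp: topspace_TH group_GH continuous_conj mult_mem_iff m_assoc inv_cancel_left
      simp del: topspace_subtopology intro!: continuous_map_TH\<close>)

lemma conj_coboundary:
  fixes f :: "(nat \<Rightarrow> 'a) \<Rightarrow> bit"
  shows "g \<in> carrier G \<Longrightarrow> conj_cochain GH G (Suc n) g (dH n f) = dH n (conj_cochain GH G n g f)"
  unfolding conj_cochain_eq by (rule coboundary_pullback_map[symmetric]) (simp add: conj_mem)

lemma conj_add:
  fixes f :: "(nat \<Rightarrow> 'a) \<Rightarrow> bit"
  shows "conj_cochain GH G n g (f + f') = conj_cochain GH G n g f + conj_cochain GH G n g f'"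
  unfolding conj_cochain_eq by (rule pullback_add)

text \<open>One half of Shapiro's lemma: on H, both the identity and \<open>retract\<close> commute
  with left translation by H, so the prism homotopy applies.\<close>

lemma res_ind_homologous:
  assumes "f \<in> CH n" "dH n f = 0"
  shows "f + res n (ind n f) \<in> BH n"
proof -
  have "pullback_map GH n (\<lambda>x. x) f + pullback_map GH n retract f \<in> BH n"
    by (rule pullback_map_homotopy[OF assms, where T'=TH and \<theta>="\<lambda>h. h"])
      (auto simp: topspace_TH group_GH retract_mult retract_mem continuous_retract
        simp del: topspace_subtopology intro!: continuous_map_TH)
  moreover have "res n (ind n f) = pullback_map GH n retract f"
    unfolding res_def ind_def by (rule pullback_map_comp) simp
  ultimately show ?thesis by (simp only: pullback_map_id[OF assms(1)])
qed

text \<open>The other half. The homotopy is H-equivariant only, so the difference is a coboundary in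
  the complex I, not in that of G; the norm of its primitive is what carries the information
  later.\<close>

lemma ind_res_homologous:
  assumes "h \<in> CG n" "d n h = 0"
  shows "h + ind n (res n h) \<in> invariant_coboundaries G T H n"
proof -
  have "pullback_map G n (\<lambda>x. x) h + pullback_map G n retract h \<in> invariant_coboundaries G T H n"
    by (rule pullback_map_homotopy[OF CG_CI[OF assms(1)] assms(2), where T'=T and \<theta>="\<lambda>h. h"])
      (auto simp: topspace is_group retract_mult continuous_retract)
  moreover have "ind n (res n h) = pullback_map G n retract h"
    unfolding res_def ind_def by (rule pullback_map_comp) (simp add: retract_mem)
  ultimately show ?thesis by (simp only: pullback_map_id[OF assms(1)])
qed

definition cor :: "nat \<Rightarrow> ((nat \<Rightarrow> 'a) \<Rightarrow> bit) \<Rightarrow> ((nat \<Rightarrow> 'a) \<Rightarrow> bit)" where "cor n = cores_cochain GH G n"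

lemma cor_eq: "f \<in> CH n \<Longrightarrow> cor n f = nrm n (ind n f)"
  unfolding cor_def by (rule cores_cochain_eq)

lemma cor_CG: "f \<in> CH n \<Longrightarrow> cor n f \<in> CG n"
  by (simp add: cor_eq nrm_CG ind_CI)

lemma d_cor: "f \<in> CH n \<Longrightarrow> d n (cor n f) = cor (Suc n) (dH n f)"
  by (simp add: cor_eq dH_CH d_nrm d_ind)

lemma cor_add: "f \<in> CH n \<Longrightarrow> g \<in> CH n \<Longrightarrow> cor n (f + g) = cor n f + cor n g"
  by (simp add: cor_eq invariant_cochains_add nrm_add ind_add)

lemma cor_zero [simp]: "cor n 0 = 0"
  by (simp add: cor_eq)

text \<open>On H the two terms of the corestriction are pullbacks along \<open>retract\<close> and
  along x -> t x inv t. The first is homotopic to the identity, the second to conjugation by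
  \<open>g\<close>. The element \<open>g\<close> is arbitrary outside H since a lift of sigma need
  not be the representative \<open>t\<close>.\<close>

lemma res_cor_homologous:
  assumes f: "f \<in> CH n" "dH n f = 0" and g: "g \<in> carrier G" "g \<notin> H"
  shows "res n (cor n f) + (f + conj_cochain GH G n g f) \<in> BH n"
proof -
  \<comment> \<open>Conjugation by \<open>inv t\<close> and by \<open>g\<close> twist the
    translations differently, so no homotopy applies directly. Left translation by
    \<open>inv g \<otimes> inv t\<close>, an element of H that leaves \<open>f\<close> unchanged,
    first makes the twists agree.\<close>
  have "pullback_map GH n (\<lambda>x. t \<otimes> x \<otimes> inv t) f = pullback_map GH n (\<lambda>x. inv g \<otimes> x \<otimes> inv t) f"
  proof
    fix x
    show "pullback_map GH n (\<lambda>x. t \<otimes> x \<otimes> inv t) f x = pullback_map GH n (\<lambda>x. inv g \<otimes> x \<otimes> inv t) f x"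
    proof (cases "x \<in> points GH n")
      case True
      then have x: "x i \<in> H" if "i \<le> n" for i using that by auto
      have p: "(\<lambda>i\<in>{..n}. t \<otimes> x i \<otimes> inv t) \<in> points GH n"
        using x by (auto simp: mult_mem_iff)
      have k: "inv g \<otimes> inv t \<in> H" using g by (simp add: mult_mem_iff)
      have e: "(\<lambda>i\<in>{..n}. (inv g \<otimes> inv t) \<otimes>\<^bsub>GH\<^esub> (\<lambda>i\<in>{..n}. t \<otimes> x i \<otimes> inv t) i)
          = (\<lambda>i\<in>{..n}. inv g \<otimes> x i \<otimes> inv t)"
        by (intro restrict_ext) (simp add: x g m_assoc inv_cancel_left)
      show ?thesis
        using True invariant_cochains_translate[OF f(1) k p] unfolding e
        by (simp add: pullback_def)
    qed (simp add: pullback_def)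
  qed
  moreover have "pullback_map GH n (\<lambda>x. inv g \<otimes> x \<otimes> inv t) f
      + pullback_map GH n (\<lambda>x. inv g \<otimes> x \<otimes> g) f \<in> BH n"
  proof (rule pullback_map_homotopy[OF f, where T'=TH and \<theta>="\<lambda>h. inv g \<otimes> h \<otimes> g"])
    show "continuous_map TH TH (\<lambda>x. inv g \<otimes> x \<otimes> inv t)"
      using continuous_map_compose[OF left_translation right_translation, of "inv g" "inv t"] g
      by (intro continuous_map_TH) (simp_all add: comp_def mult_mem_iff)
    show "continuous_map TH TH (\<lambda>x. inv g \<otimes> x \<otimes> g)"
      using g by (intro continuous_map_TH) (simp_all add: continuous_conj conj_mem)
  qed (use g in \<open>auto simp: topspace_TH group_GH mult_mem_iff m_assoc inv_cancel_left
      simp del: topspace_subtopology\<close>)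
  moreover have "res n (cor n f) = res n (ind n f) + pullback_map GH n (\<lambda>x. t \<otimes> x \<otimes> inv t) f"
  proof -
    have "pullback_map GH n (\<lambda>x. retract (t \<otimes> x)) f = pullback_map GH n (\<lambda>x. t \<otimes> x \<otimes> inv t) f"
      by (rule pullback_map_cong) (simp add: retract_def mult_mem_iff)
    moreover have "res n (pullback_map G n (\<lambda>x. t \<otimes> x) (pullback_map G n retract f))
        = pullback_map GH n (\<lambda>x. retract (t \<otimes> x)) f"
      unfolding res_def
      by (subst pullback_map_comp, simp, subst pullback_map_comp) (simp_all add: H_closed)
    ultimately show ?thesis
      by (simp only: cor_eq[OF f(1)] nrm_def ind_def res_add)
  qed
  moreover have "f + res n (ind n f) \<in> BH n" by (rule res_ind_homologous[OF f])
  ultimately have "(f + res n (ind n f)) + (pullback_map GH n (\<lambda>x. t \<otimes> x \<otimes> inv t) f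
      + pullback_map GH n (\<lambda>x. inv g \<otimes> x \<otimes> g) f) \<in> BH n"
    "res n (cor n f) = res n (ind n f) + pullback_map GH n (\<lambda>x. t \<otimes> x \<otimes> inv t) f"
    using invariant_coboundaries_add by metis+
  then show ?thesis by (simp add: conj_cochain_eq ac_simps)
qed

text \<open>Composing the two maps multiplies by the index 2, hence gives 0. Concretely, h + ind res
  h = d v in I, and taking norms kills \<open>h\<close> and leaves d of the G-invariant cochain
  \<open>nrm m v\<close>.\<close>

lemma cor_res_coboundary:
  assumes "h \<in> CG (Suc m)" "d (Suc m) h = 0"
  shows "cor (Suc m) (res (Suc m) h) \<in> BG (Suc m)"
proof -
  obtain v where v: "v \<in> CI m" "h + ind (Suc m) (res (Suc m) h) = d m v"
    using ind_res_homologous[OF assms] by (auto simp: invariant_coboundaries_Suc)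
  have "nrm (Suc m) (h + ind (Suc m) (res (Suc m) h)) = d m (nrm m v)"
    unfolding v(2) d_nrm ..
  then have "cor (Suc m) (res (Suc m) h) = d m (nrm m v)"
    by (simp add: nrm_add nrm_CG_eq_zero assms cor_eq res_CH CG_CI)
  then show ?thesis using nrm_CG[OF v(1)] by (simp add: invariant_coboundaries_Suc)
qed

text \<open>Exactness at the cohomology of H: a class killed by corestriction is a
  restriction.\<close>

lemma cor_kernel:
  assumes f: "f \<in> CH (Suc m)" "dH (Suc m) f = 0" and "cor (Suc m) f \<in> BG (Suc m)"
  obtains h where "h \<in> CG (Suc m)" "d (Suc m) h = 0" "f + res (Suc m) h \<in> BH (Suc m)"
proof -
  obtain v where v: "v \<in> CG m" "cor (Suc m) f = d m v"
    using assms(3) by (auto simp: invariant_coboundaries_Suc)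
  \<comment> \<open>The norm of \<open>ind f\<close> is d v, and \<open>half m v\<close> has norm v.
    Adding its coboundary therefore cancels the norm without changing the class in I, and the result
    descends to G.\<close>
  define z where "z = ind (Suc m) f + d m (half m v)"
  have hv: "half m v \<in> CI m" using v(1) by (intro half_CI CG_CI)
  have "nrm (Suc m) z = 0"
    using v by (simp add: z_def nrm_add nrm_half cor_eq f flip: d_nrm)
  then have z: "z \<in> CG (Suc m)"
    by (intro nrm_kernel) (auto simp: z_def intro: ind_CI f d_CI hv)
  moreover have "d (Suc m) z = 0"
    by (simp add: z_def coboundary_add d_ind f)
  moreover have "(f + res (Suc m) (ind (Suc m) f)) + dH m (res m (half m v)) \<in> BH (Suc m)"
    using res_CH[OF hv]
    by (intro invariant_coboundaries_add res_ind_homologous[OF f]) (simp add: invariant_coboundaries_Suc)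
  then have "f + res (Suc m) z \<in> BH (Suc m)"
    by (simp add: z_def res_add dH_res add.assoc)
  ultimately show ?thesis by (rule that)
qed

text \<open>Exactness at the cohomology of G. A cocycle that becomes d y in I has a closed norm g =
  nrm y, because nrm h = 0. Correcting y by \<open>half m g\<close> makes it G-invariant at the
  price of the cup product with g: this is the connecting map.\<close>

lemma res_kernel:
  assumes h: "h \<in> CG (Suc m)" "d (Suc m) h = 0" and "res (Suc m) h \<in> BH (Suc m)"
  obtains g where "g \<in> CG m" "d m g = 0" "h + cup_kummer m g \<in> BG (Suc m)"
proof -
  obtain v where v: "v \<in> CH m" "res (Suc m) h = dH m v"
    using assms(3) by (auto simp: invariant_coboundaries_Suc)
  obtain w where w: "w \<in> CI m" "h + ind (Suc m) (res (Suc m) h) = d m w"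
    using ind_res_homologous[OF h] by (auto simp: invariant_coboundaries_Suc)
  \<comment> \<open>Here w bounds h + ind res h and v bounds res h, so y bounds h itself among the
    H-invariant cochains.\<close>
  define y where "y = w + ind m v"
  have y: "y \<in> CI m" using v w by (auto simp: y_def intro: ind_CI)
  have "d m y = (h + ind (Suc m) (res (Suc m) h)) + ind (Suc m) (res (Suc m) h)"
    by (simp add: y_def coboundary_add d_ind w(2) flip: v(2))
  then have dy: "d m y = h" by (simp add: add.assoc)
  define g where "g = nrm m y"
  have g: "g \<in> CG m" "d m g = 0"
    using y by (simp_all add: g_def nrm_CG d_nrm dy nrm_CG_eq_zero h)
  have "y + half m g \<in> CI m"
    by (intro invariant_cochains_add y half_CI CG_CI g)
  moreover have "nrm m (y + half m g) = 0"
    by (simp add: nrm_add nrm_half g flip: g_def)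
  ultimately have "y + half m g \<in> CG m" by (rule nrm_kernel)
  moreover have "d m (y + half m g) = h + cup_kummer m g"
    by (simp add: coboundary_add dy d_half g)
  ultimately have "h + cup_kummer m g \<in> BG (Suc m)"
    unfolding invariant_coboundaries_Suc by (metis imageI)
  with g show ?thesis by (rule that)
qed

end

section \<open>Cohomology classes with coefficients modulo 2\<close>

lemma cocycles_eq:
  "cocycles G T n = {f \<in> invariant_cochains G T (carrier G) n. coboundary G n f = 0}"
  by (simp add: cocycles_def cochains_eq_invariant_cochains zero_fun_def)

lemma cocycles_add: "f \<in> cocycles G T n \<Longrightarrow> g \<in> cocycles G T n \<Longrightarrow> f + g \<in> cocycles G T n"
  for f :: "(nat \<Rightarrow> 'g) \<Rightarrow> bit"
  by (auto simp: cocycles_eq coboundary_add)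

lemma cocycle_group_simps [simp]:
  "carrier (cocycle_group G T n) = cocycles G T n"
  "f \<otimes>\<^bsub>cocycle_group G T n\<^esub> g = f + g"
  "\<one>\<^bsub>cocycle_group G T n\<^esub> = 0"
  by (simp_all add: cocycle_group_def plus_fun_def zero_fun_def)

lemma comm_group_cocycle_group:
  "comm_group (cocycle_group G T n :: ((nat \<Rightarrow> 'g) \<Rightarrow> bit) monoid)"
proof (rule comm_groupI)
  fix f :: "(nat \<Rightarrow> 'g) \<Rightarrow> bit"
  assume "f \<in> carrier (cocycle_group G T n)"
  then show "\<exists>g\<in>carrier (cocycle_group G T n). g \<otimes>\<^bsub>cocycle_group G T n\<^esub> f = \<one>\<^bsub>cocycle_group G T n\<^esub>"
    by (intro bexI[of _ f]) auto
qed (auto simp: cocycles_add ac_simps, simp add: cocycles_eq)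

locale discrete_cohomology = group G for G (structure) +
  fixes T :: "'a topology" and n :: nat
  assumes topspace_eq: "topspace T = carrier G"
begin

abbreviation "Z \<equiv> cocycles G T n :: ((nat \<Rightarrow> 'a) \<Rightarrow> bit) set"
abbreviation "B \<equiv> coboundaries G T n :: ((nat \<Rightarrow> 'a) \<Rightarrow> bit) set"
abbreviation "ZG \<equiv> cocycle_group G T n :: ((nat \<Rightarrow> 'a) \<Rightarrow> bit) monoid"
abbreviation "HG \<equiv> cohomology G T n :: ((nat \<Rightarrow> 'a) \<Rightarrow> bit) set monoid"
abbreviation "cls \<equiv> cohomology_class G T n :: _ \<Rightarrow> ((nat \<Rightarrow> 'a) \<Rightarrow> bit) set"

lemma coboundaries_subset: "B \<subseteq> Z"
proof (cases n)
  case (Suc m)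
  then show ?thesis
    using coboundary_invariant[of _ G T "carrier G" m, OF _ topspace_eq is_group]
    by (auto simp: cocycles_eq coboundaries_eq_invariant_coboundaries invariant_coboundaries_Suc)
qed (simp add: coboundaries_eq_invariant_coboundaries invariant_coboundaries_def cocycles_eq)

lemma coboundaries_add: "f \<in> B \<Longrightarrow> g \<in> B \<Longrightarrow> f + g \<in> B"
  by (simp add: coboundaries_eq_invariant_coboundaries invariant_coboundaries_add)

lemma coboundaries_zero [simp]: "0 \<in> B"
  by (simp add: coboundaries_eq_invariant_coboundaries)

lemma normal_coboundaries: "B \<lhd> ZG"
proof -
  interpret ZG: comm_group ZG by (rule comm_group_cocycle_group)
  have "subgroup B ZG"
  proof (rule ZG.subgroupI)
    fix f assume f: "f \<in> B"
    then have "inv\<^bsub>ZG\<^esub> f = f"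
      using coboundaries_subset by (intro ZG.inv_equality) auto
    with f show "inv\<^bsub>ZG\<^esub> f \<in> B" by simp
    next
    show "B \<noteq> {}" using coboundaries_zero by blast
  qed (use coboundaries_subset in \<open>auto simp: coboundaries_add\<close>)
  then show ?thesis by (rule ZG.subgroup_imp_normal)
qed

lemma class_iff: "g \<in> cls f \<longleftrightarrow> g + f \<in> B"
proof
  assume "g + f \<in> B"
  moreover have "g = (g + f) + f" by (simp add: add.assoc)
  ultimately have "\<exists>b\<in>B. g = b + f" by blast
  then show "g \<in> cls f" by (auto simp: cohomology_class_def r_coset_def)
qed (auto simp: cohomology_class_def r_coset_def add.assoc)

lemma class_self: "f \<in> cls f"
  by (simp add: class_iff)

lemma class_eq_iff: "cls f = cls g \<longleftrightarrow> f + g \<in> B"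
proof
  assume fg: "f + g \<in> B"
  have "h + f \<in> B \<longleftrightarrow> h + g \<in> B" for h
  proof
    assume "h + f \<in> B"
    from coboundaries_add[OF this fg] show "h + g \<in> B" by (simp add: add.assoc)
  next
    assume "h + g \<in> B"
    from coboundaries_add[OF fg this] show "h + f \<in> B" by (simp add: ac_simps)
  qed
  then show "cls f = cls g" by (auto simp: class_iff)
qed (use class_self class_iff in blast)

lemma carrier_cohomology: "carrier HG = cls ` Z"
  by (auto simp: cohomology_def FactGroup_def RCOSETS_def cohomology_class_def)

lemma one_cohomology: "\<one>\<^bsub>HG\<^esub> = B"
  by (simp add: cohomology_def FactGroup_def)

lemma class_eq_one_iff: "cls f = \<one>\<^bsub>HG\<^esub> \<longleftrightarrow> f \<in> B"
proof -
  have "cls 0 = B" by (auto simp: class_iff)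
  then show ?thesis using class_eq_iff[of f 0] one_cohomology by simp
qed

lemma mult_class: "f \<in> Z \<Longrightarrow> g \<in> Z \<Longrightarrow> cls f \<otimes>\<^bsub>HG\<^esub> cls g = cls (f + g)"
  using normal.rcos_sum[OF normal_coboundaries, of f g]
  by (simp add: cohomology_def FactGroup_def cohomology_class_def)

text \<open>Classes have order at most 2, so sigma - 1 may be read as sigma + 1.\<close>

lemma inv_class:
  assumes "f \<in> Z" shows "inv\<^bsub>HG\<^esub> cls f = cls f"
proof -
  interpret HG: group HG
    unfolding cohomology_def by (rule normal.factorgroup_is_group[OF normal_coboundaries])
  show ?thesis
  proof (rule HG.inv_equality)
    show "cls f \<otimes>\<^bsub>HG\<^esub> cls f = \<one>\<^bsub>HG\<^esub>"
      by (simp add: mult_class assms class_eq_one_iff)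
  qed (use assms in \<open>auto simp: carrier_cohomology\<close>)
qed

text \<open>The class consists of the sums f + b with b a coboundary, so the image is a singleton.
  This evaluates corestriction, conjugation and cup product on classes.\<close>

lemma the_elem_class:
  assumes "\<And>b. b \<in> B \<Longrightarrow> \<phi> (f + b) = \<phi> f"
  shows "the_elem (\<phi> ` cls f) = \<phi> f"
proof -
  have "\<phi> g = \<phi> f" if "g \<in> cls f" for g
    using assms[of "g + f"] that by (simp add: class_iff ac_simps)
  then have "\<phi> ` cls f = {\<phi> f}" using class_self by blast
  then show ?thesis by simp
qed

end

section \<open>The equivalence for an open subgroup of index two\<close>

context open_index_two
begin

text \<open>An invariant 0-cochain is constant, as G acts transitively on itself. Consequently a
  class in degree 1 has a single representative, and in the cup product with the Kummer class only
  the second factor varies.\<close>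

lemma coboundaries_one: "coboundaries G T 1 = {0 :: (nat \<Rightarrow> 'a) \<Rightarrow> bit}"
proof -
  have "d 0 f = 0" if f: "f \<in> CG 0" for f
  proof
    fix x
    show "d 0 f x = 0 x"
    proof (cases "x \<in> points G (Suc 0)")
      case True
      then have x: "x 0 \<in> carrier G" "x (Suc 0) \<in> carrier G" by auto
      \<comment> \<open>The element x_1 inv(x_0) carries x_0 to x_1.\<close>
      have "f (\<lambda>i\<in>{..0}. (x (Suc 0) \<otimes> inv (x 0)) \<otimes> (\<lambda>i\<in>{..0}. x 0) i) = f (\<lambda>i\<in>{..0}. x 0)"
        by (rule invariant_cochains_translate[OF f]) (simp_all only: restrict_PiE_iff x m_closed inv_closed ball_triv simp_thms)
      moreover have "(\<lambda>i\<in>{..0}. (x (Suc 0) \<otimes> inv (x 0)) \<otimes> (\<lambda>i\<in>{..0}. x 0) i) = face 0 0 x"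
        unfolding face_def using x by (intro restrict_ext) (simp add: m_assoc)
      moreover have "(\<lambda>i\<in>{..0}. x 0) = face 0 1 x"
        unfolding face_def by (intro restrict_ext) simp
      ultimately have "f (face 0 0 x) = f (face 0 1 x)" by metis
      then show ?thesis by (simp add: coboundary_apply[OF True])
    qed (simp add: coboundary_def)
  qed
  then have "d 0 ` CG 0 \<subseteq> {0}" by (simp add: image_subset_iff)
  moreover have "0 \<in> d 0 ` CG 0"
    using imageI[OF invariant_cochains_zero, of "d 0" G T "carrier G" 0] by (simp only: coboundary_zero)
  ultimately have "d 0 ` CG 0 = {0}" by blast
  then show ?thesis
    by (simp add: coboundaries_eq_invariant_coboundaries invariant_coboundaries_Suc flip: One_nat_def)
      (simp add: coboundaries_eq_invariant_coboundaries invariant_coboundaries_Suc)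
qed

definition cor_class where
  "cor_class n c = the_elem ((\<lambda>f. cohomology_class G T n (cores_cochain GH G n f)) ` c)"
  for c :: "((nat \<Rightarrow> 'a) \<Rightarrow> bit) set"

definition conj_class where
  "conj_class n g c = the_elem ((\<lambda>f. cohomology_class GH TH n (conj_cochain GH G n g f)) ` c)"
  for c :: "((nat \<Rightarrow> 'a) \<Rightarrow> bit) set"

text \<open>On both sides one inclusion always holds, so each equality reduces to a statement about
  cocycles modulo coboundaries. These two statements are then derived from each other by the
  exactness lemmas.\<close>

theorem kernel_cor_class_iff:
  assumes g: "g \<in> carrier G" "g \<notin> H"
  shows "kernel (cohomology GH TH (Suc m)) (cohomology G T (Suc m)) (cor_class (Suc m))
           = (\<lambda>c. conj_class (Suc m) g c \<otimes>\<^bsub>cohomology GH TH (Suc m)\<^esub> inv\<^bsub>cohomology GH TH (Suc m)\<^esub> c)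
               ` carrier (cohomology GH TH (Suc m))
         \<longleftrightarrow>
         carrier (cohomology G T (Suc m))
           = cor_class (Suc m) ` carrier (cohomology GH TH (Suc m))
             <#>\<^bsub>cohomology G T (Suc m)\<^esub>
             cup G T 1 m (cohomology_class G T 1 kummer_cocycle) ` carrier (cohomology G T m)"
    (is "?lhs \<longleftrightarrow> ?rhs")
proof -
  let ?n = "Suc m"
  interpret Gn: discrete_cohomology G T ?n by unfold_locales (rule topspace)
  interpret Gm: discrete_cohomology G T m by unfold_locales (rule topspace)
  interpret G1: discrete_cohomology G T 1 by unfold_locales (rule topspace)
  interpret Hn: discrete_cohomology GH TH ?n
    by (intro discrete_cohomology.intro discrete_cohomology_axioms.intro group_GH)
      (simp add: topspace_TH del: topspace_subtopology)
  have ZG: "f \<in> Gn.Z \<longleftrightarrow> f \<in> CG ?n \<and> d ?n f = 0" "Gn.B = BG ?n" for f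
    by (simp_all add: cocycles_eq coboundaries_eq_invariant_coboundaries)
  have Zm: "f \<in> Gm.Z \<longleftrightarrow> f \<in> CG m \<and> d m f = 0" "Gm.B = BG m" for f
    by (simp_all add: cocycles_eq coboundaries_eq_invariant_coboundaries)
  have ZH: "f \<in> Hn.Z \<longleftrightarrow> f \<in> CH ?n \<and> dH ?n f = 0" "Hn.B = BH ?n" for f
    by (simp_all add: cocycles_eq coboundaries_eq_invariant_coboundaries)
  let ?conj = "conj_cochain GH G ?n g :: ((nat \<Rightarrow> 'a) \<Rightarrow> bit) \<Rightarrow> _"

  have cor_B: "cor ?n b \<in> Gn.B" if b: "b \<in> Hn.B" for b
    using b by (auto simp: ZG ZH invariant_coboundaries_Suc cor_CG simp flip: d_cor)
  have cor_Z: "cor ?n f \<in> Gn.Z" if "f \<in> Hn.Z" for f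
    using that by (simp add: ZG ZH cor_CG d_cor)
  have conj_B: "?conj b \<in> Hn.B" if b: "b \<in> Hn.B" for b
  proof -
    obtain c where c: "c \<in> CH m" "b = dH m c"
      using b unfolding ZH invariant_coboundaries_Suc by blast
    show ?thesis
      unfolding ZH invariant_coboundaries_Suc c(2) conj_coboundary[OF g(1)]
      by (rule imageI) (rule conj_CH[OF g(1) c(1)])
  qed
  have conj_Z: "?conj f \<in> Hn.Z" if "f \<in> Hn.Z" for f
  proof -
    have "dH ?n (?conj f) = conj_cochain GH G (Suc ?n) g (dH ?n f)"
      by (rule conj_coboundary[OF g(1), symmetric])
    also have "\<dots> = 0" using that by (simp add: ZH conj_cochain_eq)
    finally show ?thesis using that conj_CH[OF g(1)] by (simp add: ZH)
  qed
  have cup_B: "cup_kummer m b \<in> Gn.B" if b: "b \<in> Gm.B" for b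
  proof (cases m)
    case 0
    have "cup_kummer m 0 = 0" by (simp add: cup_kummer_eq)
    then show ?thesis
      using b unfolding Zm using 0 Gn.coboundaries_zero by (simp add: invariant_coboundaries_def)
  next
    case (Suc k)
    have "b \<in> BG (Suc k)" using b Zm(2) Suc by simp
    then obtain c where c: "c \<in> CG k" "b = d k c"
      by (auto simp: invariant_coboundaries_Suc)
    have "cup_kummer m b = d m (cup_kummer k c)"
      unfolding Suc c(2) by (rule cup_kummer_coboundary)
    moreover have "cup_kummer k c \<in> CG m"
      unfolding Suc using c(1) by (rule cup_kummer_CG)
    ultimately show ?thesis
      by (simp only: ZG invariant_coboundaries_Suc imageI)
  qed
  have cup_Z: "cup_kummer m f \<in> Gn.Z" if "f \<in> Gm.Z" for f
    using that by (simp add: ZG Zm cup_kummer_CG d_cup_kummer)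

  have cor_class: "cor_class ?n (Hn.cls f) = Gn.cls (cor ?n f)" if f: "f \<in> Hn.Z" for f
    unfolding cor_class_def cor_def[symmetric]
  proof (rule Hn.the_elem_class)
    fix b assume b: "b \<in> Hn.B"
    then have "b \<in> Hn.Z" using Hn.coboundaries_subset by blast
    then have "cor ?n (f + b) + cor ?n f = cor ?n b"
      using f by (simp add: cor_add ZH ac_simps)
    then show "Gn.cls (cor ?n (f + b)) = Gn.cls (cor ?n f)"
      using cor_B[OF b] by (simp add: Gn.class_eq_iff)
  qed
  have conj_class: "conj_class ?n g (Hn.cls f) = Hn.cls (?conj f)" for f
    unfolding conj_class_def
  proof (rule Hn.the_elem_class)
    fix b assume b: "b \<in> Hn.B"
    have "?conj (f + b) + ?conj f = ?conj b" by (simp add: conj_add ac_simps)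
    then show "Hn.cls (?conj (f + b)) = Hn.cls (?conj f)"
      using conj_B[OF b] by (simp add: Hn.class_eq_iff)
  qed
  have kummer_class_eq: "cohomology_class G T 1 kummer_cocycle = {kummer_cocycle}"
  proof -
    have "f \<in> cohomology_class G T 1 kummer_cocycle \<longleftrightarrow> f = kummer_cocycle" for f
    proof -
      have "f + kummer_cocycle = 0 \<longleftrightarrow> f = kummer_cocycle"
        by (metis add.commute add_0_right bit_fun_add_self bit_fun_add_self_left)
      then show ?thesis using G1.class_iff[of f kummer_cocycle] unfolding coboundaries_one by simp
    qed
    then show ?thesis by blast
  qed
  have cup_class: "cup G T 1 m (cohomology_class G T 1 kummer_cocycle) (Gm.cls f) = Gn.cls (cup_kummer m f)" for f
  proof -
    have "(\<lambda>(f, g). cohomology_class G T (1 + m) (cup_cochain G 1 m f g)) ` ({kummer_cocycle} \<times> Gm.cls f)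
        = (\<lambda>f. Gn.cls (cup_kummer m f)) ` Gm.cls f"
      by (auto simp: cup_kummer_def image_iff)
    moreover have "the_elem ((\<lambda>f. Gn.cls (cup_kummer m f)) ` Gm.cls f) = Gn.cls (cup_kummer m f)"
    proof (rule Gm.the_elem_class)
      fix b assume b: "b \<in> Gm.B"
      have "cup_kummer m (f + b) + cup_kummer m f = cup_kummer m b" by (simp add: cup_kummer_add ac_simps)
      then show "Gn.cls (cup_kummer m (f + b)) = Gn.cls (cup_kummer m f)"
        using cup_B[OF b] by (simp add: Gn.class_eq_iff)
    qed
    ultimately show ?thesis unfolding cup_def kummer_class_eq by simp
  qed

  have ker: "kernel Hn.HG Gn.HG (cor_class ?n) = Hn.cls ` {f \<in> Hn.Z. cor ?n f \<in> Gn.B}"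
  proof -
    have "kernel Hn.HG Gn.HG (cor_class ?n)
        = Hn.cls ` {f \<in> Hn.Z. cor_class ?n (Hn.cls f) = \<one>\<^bsub>Gn.HG\<^esub>}"
      unfolding kernel_def Hn.carrier_cohomology by blast
    also have "{f \<in> Hn.Z. cor_class ?n (Hn.cls f) = \<one>\<^bsub>Gn.HG\<^esub>} = {f \<in> Hn.Z. cor ?n f \<in> Gn.B}"
      by (intro Collect_cong conj_cong refl) (simp only: cor_class Gn.class_eq_one_iff)
    finally show ?thesis .
  qed
  have im: "(\<lambda>c. conj_class ?n g c \<otimes>\<^bsub>Hn.HG\<^esub> inv\<^bsub>Hn.HG\<^esub> c) ` carrier Hn.HG
      = (\<lambda>f. Hn.cls (?conj f + f)) ` Hn.Z"
    unfolding Hn.carrier_cohomology image_image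
    by (intro image_cong refl) (simp add: conj_class Hn.inv_class Hn.mult_class conj_Z)
  have sum: "cor_class ?n ` carrier Hn.HG <#>\<^bsub>Gn.HG\<^esub>
      cup G T 1 m (cohomology_class G T 1 kummer_cocycle) ` carrier Gm.HG
      = {Gn.cls (cor ?n f + cup_kummer m h) |f h. f \<in> Hn.Z \<and> h \<in> Gm.Z}"
  proof -
    have "cor_class ?n ` carrier Hn.HG = (\<lambda>f. Gn.cls (cor ?n f)) ` Hn.Z"
      unfolding Hn.carrier_cohomology image_image by (intro image_cong refl cor_class)
    moreover have "cup G T 1 m (cohomology_class G T 1 kummer_cocycle) ` carrier Gm.HG
        = (\<lambda>f. Gn.cls (cup_kummer m f)) ` Gm.Z"
      unfolding Gm.carrier_cohomology image_image by (intro image_cong refl cup_class)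
    moreover have "(\<lambda>f. Gn.cls (cor ?n f)) ` Hn.Z <#>\<^bsub>Gn.HG\<^esub> (\<lambda>f. Gn.cls (cup_kummer m f)) ` Gm.Z
        = (\<Union>f\<in>Hn.Z. \<Union>h\<in>Gm.Z. {Gn.cls (cor ?n f) \<otimes>\<^bsub>Gn.HG\<^esub> Gn.cls (cup_kummer m h)})"
      unfolding set_mult_def by blast
    moreover have "\<dots> = (\<Union>f\<in>Hn.Z. \<Union>h\<in>Gm.Z. {Gn.cls (cor ?n f + cup_kummer m h)})"
      by (intro SUP_cong refl) (simp only: Gn.mult_class cor_Z cup_Z)
    moreover have "\<dots> = {Gn.cls (cor ?n f + cup_kummer m h) |f h. f \<in> Hn.Z \<and> h \<in> Gm.Z}" by blast
    ultimately show ?thesis by simp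
  qed

  have res_cor: "res ?n (cor ?n f) + (f + ?conj f) \<in> Hn.B" if "f \<in> Hn.Z" for f
    using res_cor_homologous[OF _ _ g] that by (simp add: ZH)
  have res_B: "res ?n b \<in> Hn.B" if "b \<in> Gn.B" for b
    using that by (auto simp: ZG ZH invariant_coboundaries_Suc res_CH CG_CI simp flip: dH_res)
  \<comment> \<open>The image of sigma + 1 lies in the kernel since (sigma + 1) f is homologous to
    res cor f, and cor res vanishes.\<close>
  have cor_image: "cor ?n (?conj f + f) \<in> Gn.B" if f: "f \<in> Hn.Z" for f
  proof -
    have c: "cor ?n f \<in> CG ?n" "d ?n (cor ?n f) = 0" using cor_Z[OF f] by (simp_all add: ZG)
    let ?b = "res ?n (cor ?n f) + (f + ?conj f)"
    have "?b \<in> CH ?n" using res_cor[OF f] Hn.coboundaries_subset by (auto simp: ZH)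
    moreover have "res ?n (cor ?n f) \<in> CH ?n" by (intro res_CH CG_CI c)
    moreover have "?conj f + f = res ?n (cor ?n f) + ?b" by (simp add: ac_simps)
    ultimately have "cor ?n (?conj f + f) = cor ?n (res ?n (cor ?n f)) + cor ?n ?b"
      by (simp only: cor_add)
    also have "\<dots> \<in> Gn.B"
      using cor_res_coboundary[OF c] cor_B[OF res_cor[OF f]]
      by (intro Gn.coboundaries_add) (simp_all add: ZG)
    finally show ?thesis .
  qed

  have eq_iff: "X = Y \<longleftrightarrow> X \<subseteq> Y" if "Y \<subseteq> X" for X Y :: "((nat \<Rightarrow> 'a) \<Rightarrow> bit) set set"
    using that by blast
  \<comment> \<open>\<open>?P\<close> is the inclusion of the kernel in the image of sigma + 1;
    \<open>?Q\<close> is the decomposition of every cocycle of G as a corestriction plus a cup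
    product.\<close>
  let ?P = "\<forall>f \<in> Hn.Z. cor ?n f \<in> Gn.B \<longrightarrow> (\<exists>f' \<in> Hn.Z. f + (?conj f' + f') \<in> Hn.B)"
  let ?Q = "\<forall>h \<in> Gn.Z. \<exists>f \<in> Hn.Z. \<exists>k \<in> Gm.Z. h + (cor ?n f + cup_kummer m k) \<in> Gn.B"
  have "?lhs \<longleftrightarrow> Hn.cls ` {f \<in> Hn.Z. cor ?n f \<in> Gn.B} \<subseteq> (\<lambda>f. Hn.cls (?conj f + f)) ` Hn.Z"
  proof -
    have "(\<lambda>f. Hn.cls (?conj f + f)) ` Hn.Z \<subseteq> Hn.cls ` {f \<in> Hn.Z. cor ?n f \<in> Gn.B}"
    proof (rule image_subsetI)
      fix f assume "f \<in> Hn.Z"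
      then have "?conj f + f \<in> {f \<in> Hn.Z. cor ?n f \<in> Gn.B}"
        using cor_image cocycles_add[OF conj_Z] by simp
      then show "Hn.cls (?conj f + f) \<in> Hn.cls ` {f \<in> Hn.Z. cor ?n f \<in> Gn.B}" by (rule imageI)
    qed
    then show ?thesis unfolding ker im by (rule eq_iff)
  qed
  also have "\<dots> \<longleftrightarrow> ?P"
    by (simp only: image_subset_iff image_iff Hn.class_eq_iff) blast
  finally have P: "?lhs \<longleftrightarrow> ?P" .
  have "?rhs \<longleftrightarrow> Gn.cls ` Gn.Z \<subseteq> {Gn.cls (cor ?n f + cup_kummer m h) |f h. f \<in> Hn.Z \<and> h \<in> Gm.Z}"
  proof -
    have "{Gn.cls (cor ?n f + cup_kummer m h) |f h. f \<in> Hn.Z \<and> h \<in> Gm.Z} \<subseteq> Gn.cls ` Gn.Z"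
      using cocycles_add[OF cor_Z cup_Z] by auto
    then show ?thesis unfolding sum Gn.carrier_cohomology by (rule eq_iff)
  qed
  also have "\<dots> \<longleftrightarrow> ?Q"
    by (simp only: image_subset_iff mem_Collect_eq Gn.class_eq_iff) blast
  finally have Q: "?rhs \<longleftrightarrow> ?Q" .

  \<comment> \<open>As cor res h = 0, \<open>?P\<close> gives f with res h homologous to (sigma + 1)
    f, hence to res cor f. So h + cor f restricts to zero and is a cup product up to a
    coboundary.\<close>
  have "?Q" if P: "?P"
  proof
    fix h assume "h \<in> Gn.Z"
    then have h: "h \<in> CG ?n" "d ?n h = 0" by (simp_all add: ZG)
    then have rh: "res ?n h \<in> Hn.Z" by (simp add: ZH res_CH CG_CI dH_res)
    have "cor ?n (res ?n h) \<in> Gn.B" using cor_res_coboundary[OF h] by (simp add: ZG)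
    with P rh obtain f where f: "f \<in> Hn.Z" "res ?n h + (?conj f + f) \<in> Hn.B" by blast
    have "(res ?n h + (?conj f + f)) + (res ?n (cor ?n f) + (f + ?conj f)) \<in> Hn.B"
      by (rule Hn.coboundaries_add[OF f(2) res_cor[OF f(1)]])
    then have "res ?n (h + cor ?n f) \<in> BH ?n" by (simp add: ZH res_add ac_simps)
    moreover have "h + cor ?n f \<in> CG ?n" "d ?n (h + cor ?n f) = 0"
      using cor_Z[OF f(1)] h by (auto simp: ZG coboundary_add)
    ultimately obtain k where "k \<in> CG m" "d m k = 0" "(h + cor ?n f) + cup_kummer m k \<in> BG ?n"
      using res_kernel by blast
    then have "k \<in> Gm.Z" "h + (cor ?n f + cup_kummer m k) \<in> Gn.B"
      by (simp_all add: ZG Zm add.assoc)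
    with f(1) show "\<exists>f \<in> Hn.Z. \<exists>k \<in> Gm.Z. h + (cor ?n f + cup_kummer m k) \<in> Gn.B" by blast
  qed
  \<comment> \<open>A class f killed by corestriction is some res h. Decomposing h by
    \<open>?Q\<close> and restricting kills the cup product, so f is homologous to res cor f', that
    is to (sigma + 1) f'.\<close>
  moreover have "?P" if Q: "?Q"
  proof (intro ballI impI)
    fix f assume f: "f \<in> Hn.Z" "cor ?n f \<in> Gn.B"
    then obtain h where h: "h \<in> CG ?n" "d ?n h = 0" "f + res ?n h \<in> BH ?n"
      using cor_kernel[of f m] by (auto simp: ZG ZH)
    then obtain f' k where f': "f' \<in> Hn.Z" and k: "h + (cor ?n f' + cup_kummer m k) \<in> Gn.B"
      using Q by (metis ZG(1))
    have k1: "res ?n h + res ?n (cor ?n f') \<in> Hn.B"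
      using res_B[OF k] by (simp add: res_add res_cup_kummer)
    have k2: "f + res ?n h \<in> Hn.B" using h by (simp add: ZH)
    have "(f + res ?n h) + ((res ?n h + res ?n (cor ?n f'))
        + (res ?n (cor ?n f') + (f' + ?conj f'))) \<in> Hn.B"
      by (rule Hn.coboundaries_add[OF k2 Hn.coboundaries_add[OF k1 res_cor[OF f']]])
    then have "f + (?conj f' + f') \<in> Hn.B" by (simp add: ac_simps)
    with f' show "\<exists>f' \<in> Hn.Z. f + (?conj f' + f') \<in> Hn.B" by blast
  qed
  ultimately show ?thesis unfolding P Q by blast
qed

end

section \<open>Extension of homomorphisms to the separable closure\<close>

text \<open>
  A partial homomorphism over \<open>F\<close> is represented by its graph, a subring of \<open>'s \<times> 's\<close>.
\<close>

definition partial_hom :: "'s::field set \<Rightarrow> ('s \<times> 's) set \<Rightarrow> bool" where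
  "partial_hom F R \<longleftrightarrow>
     (\<forall>c\<in>F. (c, c) \<in> R) \<and>
     (\<forall>(x, y)\<in>R. \<forall>(x', y')\<in>R. (x + x', y + y') \<in> R \<and> (x * x', y * y') \<in> R) \<and>
     (\<forall>y. (0, y) \<in> R \<longrightarrow> y = 0)"

lemma partial_homI:
  assumes "\<And>c. c \<in> F \<Longrightarrow> (c, c) \<in> R"
    and "\<And>x y x' y'. (x, y) \<in> R \<Longrightarrow> (x', y') \<in> R \<Longrightarrow> (x + x', y + y') \<in> R"
    and "\<And>x y x' y'. (x, y) \<in> R \<Longrightarrow> (x', y') \<in> R \<Longrightarrow> (x * x', y * y') \<in> R"
    and "\<And>y. (0, y) \<in> R \<Longrightarrow> y = 0"
  shows "partial_hom F R"
  using assms unfolding partial_hom_def by blast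

definition coeffs_in :: "'s::field set \<Rightarrow> 's poly \<Rightarrow> bool" where
  "coeffs_in F p \<longleftrightarrow> (\<forall>i. coeff p i \<in> F)"

text \<open>As with the partial homomorphism itself, applying it to coefficients is kept as a
  relation: q is the image of p.\<close>

definition poly_pair :: "('s::field \<times> 's) set \<Rightarrow> 's poly \<Rightarrow> 's poly \<Rightarrow> bool" where
  "poly_pair R p q \<longleftrightarrow> (\<forall>i. (coeff p i, coeff q i) \<in> R)"

text \<open>By the product rule a common divisor of p and its derivative also divides f and the
  derivative of f. This passes separability from a polynomial over F to the image of a minimal
  polynomial.\<close>

lemma coprime_pderiv_dvd:
  fixes p f :: "'s::field poly"
  assumes "p dvd f" "coprime f (pderiv f)"
  shows "coprime p (pderiv p)"
proof (rule coprimeI)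
  fix c assume c: "c dvd p" "c dvd pderiv p"
  from assms(1) obtain k where "f = p * k" by blast
  then have "c dvd f" "c dvd pderiv f" using c by (auto simp: pderiv_mult)
  with assms(2) show "is_unit c" by (rule coprime_common_divisor)
qed

locale separable_closure =
  fixes F :: "'s::field set"
  assumes closes: "separably_closes F"
begin

lemma F_closed:
  "0 \<in> F" "1 \<in> F" "x \<in> F \<Longrightarrow> y \<in> F \<Longrightarrow> x + y \<in> F" "x \<in> F \<Longrightarrow> y \<in> F \<Longrightarrow> x * y \<in> F"
  "x \<in> F \<Longrightarrow> - x \<in> F" "x \<in> F \<Longrightarrow> inverse x \<in> F"
  using closes by (auto simp: separably_closes_def is_subfield_def)

lemma separable_polynomial:
  obtains f where "coeffs_in F f" "coprime f (pderiv f)" "poly f x = 0" "f \<noteq> 0"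
proof -
  obtain f where f: "coeffs_in F f" "coprime f (pderiv f)" "poly f x = 0"
    using closes unfolding separably_closes_def coeffs_in_def by meson
  moreover have "f \<noteq> 0" using f(2) by auto
  ultimately show ?thesis by (rule that)
qed

lemma separable_root: "degree (p :: 's poly) > 0 \<Longrightarrow> coprime p (pderiv p) \<Longrightarrow> \<exists>x. poly p x = 0"
  using closes unfolding separably_closes_def by blast

end

locale partial_hom_closure = separable_closure F for F :: "'s::field set" +
  fixes R :: "('s \<times> 's) set"
  assumes hom: "partial_hom F R"
begin

lemma R_closed:
  "c \<in> F \<Longrightarrow> (c, c) \<in> R"
  "(x, y) \<in> R \<Longrightarrow> (x', y') \<in> R \<Longrightarrow> (x + x', y + y') \<in> R"
  "(x, y) \<in> R \<Longrightarrow> (x', y') \<in> R \<Longrightarrow> (x * x', y * y') \<in> R"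
  "(0, y) \<in> R \<Longrightarrow> y = 0"
  using hom unfolding partial_hom_def by blast+

lemma R_zero [simp]: "(0, 0) \<in> R" and R_one [simp]: "(1, 1) \<in> R"
  by (auto intro: R_closed(1) F_closed)

lemma R_minus: "(x, y) \<in> R \<Longrightarrow> (- x, - y) \<in> R"
  using R_closed(3)[OF R_closed(1)[OF F_closed(5)[OF F_closed(2)]]] by fastforce

lemma R_diff: "(x, y) \<in> R \<Longrightarrow> (x', y') \<in> R \<Longrightarrow> (x - x', y - y') \<in> R"
  using R_closed(2)[OF _ R_minus] by fastforce

lemma R_unique: "(x, y) \<in> R \<Longrightarrow> (x, y') \<in> R \<Longrightarrow> y = y'"
  using R_diff[of x y x y'] R_closed(4)[of "y - y'"] by simp

lemma R_sum: "(\<And>i. i \<in> I \<Longrightarrow> (f i, g i) \<in> R) \<Longrightarrow> (sum f I, sum g I) \<in> R"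
  by (induction I rule: infinite_finite_induct) (auto intro: R_closed)

lemma poly_pair_F: "coeffs_in F f \<Longrightarrow> poly_pair R f f"
  by (simp add: coeffs_in_def poly_pair_def R_closed)

lemma poly_pair_pCons [simp]: "poly_pair R (pCons a p) (pCons b q) \<longleftrightarrow> (a, b) \<in> R \<and> poly_pair R p q"
  by (auto simp: poly_pair_def coeff_pCons split: nat.splits)

lemma poly_pair_0 [simp]: "poly_pair R 0 0"
  by (simp add: poly_pair_def)

lemma poly_pair_add: "poly_pair R p q \<Longrightarrow> poly_pair R p' q' \<Longrightarrow> poly_pair R (p + p') (q + q')"
  by (simp add: poly_pair_def R_closed)

lemma poly_pair_diff: "poly_pair R p q \<Longrightarrow> poly_pair R p' q' \<Longrightarrow> poly_pair R (p - p') (q - q')"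
  by (simp add: poly_pair_def R_diff)

lemma poly_pair_mult: "poly_pair R p q \<Longrightarrow> poly_pair R p' q' \<Longrightarrow> poly_pair R (p * p') (q * q')"
  unfolding poly_pair_def coeff_mult by (intro allI R_sum R_closed(3)) auto

lemma poly_pair_smult: "(a, b) \<in> R \<Longrightarrow> poly_pair R p q \<Longrightarrow> poly_pair R (smult a p) (smult b q)"
  by (simp add: poly_pair_def R_closed)

lemma poly_pair_zero_left: "poly_pair R 0 q \<Longrightarrow> q = 0"
  by (rule poly_eqI) (simp add: poly_pair_def R_closed(4))

lemma poly_pair_poly:
  assumes "(x, y) \<in> R" shows "poly_pair R p q \<Longrightarrow> (poly p x, poly q y) \<in> R"
proof (induction p arbitrary: q)
  case 0
  then have "q = 0" by (rule poly_pair_zero_left)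
  then show ?case by simp
next
  case (pCons a p)
  obtain b q' where "q = pCons b q'" by (cases q)
  with pCons assms show ?case by (auto intro!: R_closed)
qed

text \<open>The domain of R is only known to be a ring, but z is algebraic over F. After removing
  factors X, a polynomial relation reads c + z p(z) = 0 with c nonzero in F, so inverse z = -
  inverse c * p(z) is in the domain.\<close>

lemma R_inverse:
  assumes "(z, w) \<in> R" "z \<noteq> 0" obtains v where "(inverse z, v) \<in> R"
proof -
  have "\<exists>v. (inverse z, v) \<in> R" if "p \<noteq> 0" "coeffs_in F p" "poly p z = 0" for p
    using that
  proof (induction p)
    case (pCons c p)
    have p: "coeffs_in F p" "c \<in> F"
      using pCons.prems(2) unfolding coeffs_in_def
      by (metis coeff_pCons_Suc, metis coeff_pCons_0)
    show ?case
    proof (cases "c = 0")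
      case True
      then have "p \<noteq> 0" "poly p z = 0" using pCons.prems assms(2) by auto
      then show ?thesis using pCons.IH p by blast
    next
      case False
      have "(poly p z, poly p w) \<in> R"
        using poly_pair_poly[OF assms(1)] poly_pair_F p by blast
      moreover have "(- inverse c, - inverse c) \<in> R"
        by (intro R_closed F_closed p)
      ultimately have "(- inverse c * poly p z, - inverse c * poly p w) \<in> R"
        by (rule R_closed(3)[rotated])
      moreover have "inverse z = - inverse c * poly p z"
      proof (rule inverse_unique)
        have "z * poly p z = - c"
          using pCons.prems(3) by (simp add: eq_neg_iff_add_eq_0 add.commute)
        then have "z * (- inverse c * poly p z) = - inverse c * (- c)"
          using mult.left_commute[of z "- inverse c" "poly p z"] by simp
        then show "z * (- inverse c * poly p z) = 1" using False by simp
      qed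
      ultimately show ?thesis by auto
    qed
  qed simp
  then show ?thesis using separable_polynomial[of z] that by metis
qed

text \<open>
  Adjoining \<open>x\<close>: the pair \<open>(p, p')\<close> consists of the minimal polynomial of \<open>x\<close> over the domain
  of the partial homomorphism and of its image, any root of which is a possible image of \<open>x\<close>.
\<close>

lemma minimal_pair:
  obtains p p' where "poly_pair R p p'" "poly p x = 0" "degree p > 0" "degree p' = degree p"
    "\<forall>q q'. poly_pair R q q' \<and> poly q x = 0 \<longrightarrow> (\<exists>k k'. poly_pair R k k' \<and> q = k * p \<and> q' = k' * p')"
proof -
  define P where "P n \<longleftrightarrow> (\<exists>p p'. poly_pair R p p' \<and> poly p x = 0 \<and> p \<noteq> 0 \<and> degree p = n)" for n
  obtain f where f: "coeffs_in F f" "poly f x = 0" "f \<noteq> 0" by (rule separable_polynomial)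
  have ex: "P (degree f)" unfolding P_def using f poly_pair_F by blast
  define n where "n = (LEAST n. P n)"
  have "P n" unfolding n_def using ex by (rule LeastI)
  then obtain p0 p0' where p0: "poly_pair R p0 p0'" "poly p0 x = 0" "p0 \<noteq> 0" "degree p0 = n"
    unfolding P_def by blast
  have least: "q = 0" if "poly_pair R q q'" "poly q x = 0" "degree q < n" for q q'
  proof (rule ccontr)
    assume "q \<noteq> 0"
    then have "P (degree q)" unfolding P_def using that by blast
    then have "n \<le> degree q" unfolding n_def by (rule Least_le)
    with that show False by simp
  qed
  obtain v where v: "(inverse (lead_coeff p0), v) \<in> R"
    using R_inverse[of "lead_coeff p0" "coeff p0' n"] p0 unfolding poly_pair_def by (metis leading_coeff_0_iff)
  \<comment> \<open>The polynomial is made monic so that its image is monic of the same degree: the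
    coefficient 1 can only correspond to 1.\<close>
  define p p' where "p = smult (inverse (lead_coeff p0)) p0" and "p' = smult v p0'"
  have p: "poly_pair R p p'" using v p0 by (simp add: p_def p'_def poly_pair_smult)
  have "poly p x = 0" "degree p = degree p0" "lead_coeff p = 1"
    using p0(2,3) by (simp_all add: p_def)
  with p0(4) have px: "poly p x = 0" "degree p = n" "lead_coeff p = 1"
    by simp_all
  have coeffp: "(coeff p i, coeff p' i) \<in> R" for i using p by (simp add: poly_pair_def)
  have p'n: "coeff p' n = 1"
    using coeffp[of n] px(2,3) R_unique[OF _ R_one] by simp
  have "coeff p' i = 0" if "i > n" for i
    using coeffp[of i] that px(2) R_closed(4) by (simp add: coeff_eq_0)
  then have "degree p' \<le> n" by (intro degree_le) blast
  moreover have "n \<le> degree p'" using p'n by (intro le_degree) simp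
  ultimately have p': "degree p' = n" by (rule antisym)
  have "degree p \<noteq> 0"
  proof
    assume "degree p = 0"
    then have "p = [:1:]" using px(2,3) by (metis degree_0_id)
    with px(1) show False by simp
  qed
  \<comment> \<open>Division with remainder is carried out on the polynomial and on its image at
    once, so that the quotients and remainders correspond as well.\<close>
  have div: "\<exists>k k' r r'. poly_pair R k k' \<and> poly_pair R r r' \<and> q = k * p + r \<and> q' = k' * p' + r' \<and> degree r < n"
    if "poly_pair R q q'" for q q'
    using that
  proof (induction q arbitrary: q')
    case 0
    then have "q' = 0" by (rule poly_pair_zero_left)
    then show ?case using \<open>degree p \<noteq> 0\<close> px(2)
      by (intro exI[of _ 0]) simp
  next
    case (pCons a q)
    obtain b q1 where q': "q' = pCons b q1" by (cases q')
    have ab: "(a, b) \<in> R" and q: "poly_pair R q q1" using pCons.prems q' by simp_all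
    obtain k k' r r' where IH: "poly_pair R k k'" "poly_pair R r r'"
      "q = k * p + r" "q1 = k' * p' + r'" "degree r < n"
      using pCons.IH[OF q] by blast
    define s s' where "s = pCons a r" and "s' = pCons b r'"
    have s: "poly_pair R s s'" using IH ab by (simp add: s_def s'_def)
    \<comment> \<open>Prepending a coefficient may raise the degree of the remainder to n;
      subtracting e times the monic p clears that coefficient.\<close>
    define e e' where "e = coeff s n" and "e' = coeff s' n"
    have e: "(e, e') \<in> R" using s by (simp add: e_def e'_def poly_pair_def)
    have "degree s \<le> n" using IH(5) by (simp add: s_def degree_pCons_eq_if)
    have "degree (s - smult e p) < n"
    proof -
      have "degree (s - smult e p) \<le> n"
        using \<open>degree s \<le> n\<close> px(2) by (intro degree_diff_le) (auto intro: order_trans[OF degree_smult_le])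
      moreover have "coeff (s - smult e p) n = 0" using px by (simp add: e_def)
      ultimately show ?thesis using \<open>degree p \<noteq> 0\<close> px(2)
        by (metis eq_zero_or_degree_less degree_0 gr0I)
    qed
    moreover have "poly_pair R (pCons e k) (pCons e' k')" using IH e by simp
    moreover have "poly_pair R (s - smult e p) (s' - smult e' p')"
      by (intro poly_pair_diff poly_pair_smult s e p)
    moreover have "pCons a q = pCons e k * p + (s - smult e p)"
      "q' = pCons e' k' * p' + (s' - smult e' p')"
      by (simp_all add: q' IH s_def s'_def)
    ultimately show ?case by blast
  qed
  have "\<exists>k k'. poly_pair R k k' \<and> q = k * p \<and> q' = k' * p'" if q: "poly_pair R q q'" "poly q x = 0" for q q'
  proof -
    obtain k k' r r' where k: "poly_pair R k k'" "poly_pair R r r'" "q = k * p + r" "q' = k' * p' + r'"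
      "degree r < n" using div[OF q(1)] by blast
    have "poly r x = 0" using k(3) q(2) px(1) by simp
    then have "r = 0" using least k by blast
    then have "r' = 0" using k(2) poly_pair_zero_left by blast
    with k \<open>r = 0\<close> show ?thesis by auto
  qed
  then have "\<forall>q q'. poly_pair R q q' \<and> poly q x = 0 \<longrightarrow>
      (\<exists>k k'. poly_pair R k k' \<and> q = k * p \<and> q' = k' * p')" by blast
  then show ?thesis
    by (rule that[OF p px(1), rotated 2]) (use px(2) p' \<open>degree p \<noteq> 0\<close> in simp_all)
qed

text \<open>The image p' of the minimal polynomial divides a separable polynomial over F, so it has
  a root y, and x is sent to y. This is well defined: if q(x) = 0 then p divides q with quotient k,
  so q' = k' p' vanishes at y.\<close>

lemma extend:
  obtains y R' where "R \<subseteq> R'" "(x, y) \<in> R'" "partial_hom F R'"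
proof -
  obtain p p' where p: "poly_pair R p p'" "poly p x = 0" "degree p > 0" "degree p' = degree p"
    and "\<forall>q q'. poly_pair R q q' \<and> poly q x = 0 \<longrightarrow>
        (\<exists>k k'. poly_pair R k k' \<and> q = k * p \<and> q' = k' * p')"
    by (rule minimal_pair)
  then have div: "\<exists>k k'. poly_pair R k k' \<and> q = k * p \<and> q' = k' * p'"
    if "poly_pair R q q'" "poly q x = 0" for q q'
    using that by blast
  obtain f where f: "coeffs_in F f" "coprime f (pderiv f)" "poly f x = 0"
    by (rule separable_polynomial)
  have "p' dvd f" using div[OF poly_pair_F[OF f(1)] f(3)] by auto
  then have "coprime p' (pderiv p')" using f(2) by (rule coprime_pderiv_dvd)
  then obtain y where y: "poly p' y = 0" using separable_root[of p'] p by auto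
  define R' where "R' = {(poly q x, poly q' y) |q q'. poly_pair R q q'}"
  have R'I: "(poly q x, poly q' y) \<in> R'" if "poly_pair R q q'" for q q'
    using that unfolding R'_def by blast
  have "R \<subseteq> R'"
  proof (rule subrelI)
    fix a b assume "(a, b) \<in> R"
    then show "(a, b) \<in> R'" using R'I[of "[:a:]" "[:b:]"] by simp
  qed
  moreover have "(x, y) \<in> R'"
    using R'I[of "[:0, 1:]" "[:0, 1:]"] by simp
  moreover have "partial_hom F R'"
  proof (rule partial_homI)
    show "(c, c) \<in> R'" if "c \<in> F" for c using that \<open>R \<subseteq> R'\<close> R_closed(1) by blast
    fix a b a' b' assume "(a, b) \<in> R'" "(a', b') \<in> R'"
    then obtain q q' r r' where "poly_pair R q q'" "poly_pair R r r'"
      and eq: "a = poly q x" "b = poly q' y" "a' = poly r x" "b' = poly r' y"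
      unfolding R'_def by blast
    then have "poly_pair R (q + r) (q' + r')" "poly_pair R (q * r) (q' * r')"
      by (simp_all only: poly_pair_add poly_pair_mult)
    from this[THEN R'I] show "(a + a', b + b') \<in> R'" "(a * a', b * b') \<in> R'"
      by (simp_all only: eq poly_add poly_mult)
  next
    fix b assume "(0, b) \<in> R'"
    then obtain q q' where "poly_pair R q q'" "poly q x = 0" "b = poly q' y"
      unfolding R'_def by auto
    then show "b = 0" using div[of q q'] y by auto
  qed
  ultimately show ?thesis by (rule that)
qed

end

context separable_closure
begin

text \<open>Unions of chains are again partial homomorphisms, and by \<open>extend\<close> a maximal
  one leaves no element outside its domain.\<close>

lemma maximal_partial_hom:
  assumes "partial_hom F R"
  obtains M where "R \<subseteq> M" "partial_hom F M" "\<And>x. \<exists>y. (x, y) \<in> M"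
proof -
  let ?A = "{R'. R \<subseteq> R' \<and> partial_hom F R'}"
  have "\<exists>M\<in>?A. \<forall>X\<in>?A. M \<subseteq> X \<longrightarrow> X = M"
  proof (rule subset_Zorn_nonempty)
    show "?A \<noteq> {}" using assms by blast
    fix C assume C: "C \<noteq> {}" "subset.chain ?A C"
    then have CA: "R \<subseteq> X" "partial_hom F X" if "X \<in> C" for X
      using that by (auto simp: subset_chain_def)
    have two: "\<exists>X\<in>C. u \<in> X \<and> v \<in> X" if "u \<in> \<Union>C" "v \<in> \<Union>C" for u v
      using that C(2) unfolding subset_chain_def by blast
    have "partial_hom F (\<Union>C)"
    proof (rule partial_homI)
      show "(c, c) \<in> \<Union>C" if "c \<in> F" for c
        using that C(1) CA(2) unfolding partial_hom_def by blast
      fix x y x' y' assume "(x, y) \<in> \<Union>C" "(x', y') \<in> \<Union>C"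
      then obtain X where "X \<in> C" "(x, y) \<in> X" "(x', y') \<in> X" using two by blast
      moreover from this have "(x + x', y + y') \<in> X" "(x * x', y * y') \<in> X"
        using CA(2)[of X] unfolding partial_hom_def by blast+
      ultimately show "(x + x', y + y') \<in> \<Union>C" "(x * x', y * y') \<in> \<Union>C" by blast+
    next
      fix y assume "(0, y) \<in> \<Union>C"
      then show "y = 0" using CA(2) unfolding partial_hom_def by blast
    qed
    moreover have "R \<subseteq> \<Union>C" using C(1) CA(1) by blast
    ultimately show "\<Union>C \<in> ?A" by blast
  qed
  then obtain M where M: "R \<subseteq> M" "partial_hom F M"
    and max: "\<And>X. M \<subseteq> X \<Longrightarrow> partial_hom F X \<Longrightarrow> X = M"
    by (smt (verit) mem_Collect_eq order_trans)
  interpret partial_hom_closure F M by unfold_locales (rule M)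
  have "\<exists>y. (x, y) \<in> M" for x
    using extend[of x] max by metis
  with M show ?thesis by (intro that)
qed

lemma carrier_abs_galois:
  "g \<in> carrier (abs_galois K) \<longleftrightarrow>
    bij g \<and> (\<forall>x y. g (x + y) = g x + g y \<and> g (x * y) = g x * g y) \<and> (\<forall>x\<in>K. g x = x)"
  by (simp add: galois_group_def Bij_def extensional_UNIV)

lemma extend_automorphism:
  assumes "partial_hom F R"
  obtains g where "g \<in> carrier (abs_galois F)" "\<forall>x y. (x, y) \<in> R \<longrightarrow> g x = y"
proof -
  obtain M where M: "R \<subseteq> M" "partial_hom F M" "\<And>x. \<exists>y. (x, y) \<in> M"
    using maximal_partial_hom[OF assms] by blast
  interpret partial_hom_closure F M by unfold_locales (rule M)
  obtain g where g: "\<And>x. (x, g x) \<in> M" using M(3) by metis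
  have g_eq: "g x = y" if "(x, y) \<in> M" for x y using R_unique[OF g that] .
  have add: "g (x + y) = g x + g y" and mult: "g (x * y) = g x * g y" for x y
    using R_closed(2,3)[OF g g] by (auto intro: g_eq)
  have F: "g c = c" if "c \<in> F" for c using R_closed(1)[OF that] by (rule g_eq)
  have g0: "x = 0" if "g x = 0" for x
  proof (rule ccontr)
    assume "x \<noteq> 0"
    then have "g x * g (inverse x) = 1" using mult[of x "inverse x"] F[OF F_closed(2)] by simp
    with that show False by simp
  qed
  have diff: "g (x - y) = g x - g y" for x y
    using add[of "x - y" y] by (simp add: algebra_simps)
  have "inj g"
    by (rule injI) (use g0 diff in \<open>metis right_minus_eq\<close>)
  moreover have "surj g"
    unfolding surj_def
  proof
    fix y
    \<comment> \<open>Surjectivity: g maps the finite root set of a polynomial over F to itself, and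
      injectivity makes this a permutation, so the root y is attained.\<close>
    obtain f where f: "coeffs_in F f" "poly f y = 0" "f \<noteq> 0" by (rule separable_polynomial)
    let ?Z = "{x. poly f x = 0}"
    have "finite ?Z" by (rule poly_roots_finite[OF f(3)])
    moreover have "g x \<in> ?Z" if "x \<in> ?Z" for x
    proof -
      have "(poly f x, poly f (g x)) \<in> M" by (rule poly_pair_poly[OF g poly_pair_F[OF f(1)]])
      then show ?thesis using that R_closed(4) by simp
    qed
    then have "g ` ?Z \<subseteq> ?Z" by blast
    moreover have "inj_on g ?Z" using \<open>inj g\<close> inj_on_subset by blast
    ultimately have "g ` ?Z = ?Z" by (rule endo_inj_surj)
    then have "y \<in> g ` ?Z" using f(2) by simp
    then show "\<exists>x. y = g x" by auto
  qed
  ultimately have "g \<in> carrier (abs_galois F)"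
    unfolding carrier_abs_galois using add mult F by (simp add: bij_def)
  then show ?thesis using M(1) g_eq by (intro that) auto
qed

end

section \<open>Quadratic extensions\<close>

lemma is_subfield_closed:
  assumes "is_subfield K"
  shows "0 \<in> K" "1 \<in> K" "x \<in> K \<Longrightarrow> y \<in> K \<Longrightarrow> x + y \<in> K" "x \<in> K \<Longrightarrow> y \<in> K \<Longrightarrow> x * y \<in> K"
    "x \<in> K \<Longrightarrow> - x \<in> K" "x \<in> K \<Longrightarrow> inverse x \<in> K"
  using assms by (auto simp: is_subfield_def)

lemma carrier_galois_group:
  "g \<in> carrier (galois_group L K) \<longleftrightarrow>
    g \<in> Bij L \<and> (\<forall>x\<in>L. \<forall>y\<in>L. g (x + y) = g x + g y \<and> g (x * y) = g x * g y) \<and> (\<forall>x\<in>K. g x = x)"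
  by (simp add: galois_group_def)

section \<open>Galois groups and the Krull topology\<close>

lemma group_galois_group:
  assumes L: "is_subfield L" and "K \<subseteq> L"
  shows "group (galois_group L K)"
proof -
  note cl = is_subfield_closed[OF L]
  have "subgroup (carrier (galois_group L K)) (BijGroup L)"
  proof (rule group.subgroupI[OF group_BijGroup])
    show "carrier (galois_group L K) \<subseteq> carrier (BijGroup L)"
      by (auto simp: carrier_galois_group BijGroup_def)
    have "(\<lambda>x\<in>L. x) \<in> carrier (galois_group L K)"
      using cl assms(2) by (auto simp: carrier_galois_group id_Bij)
    then show "carrier (galois_group L K) \<noteq> {}" by blast
  next
    fix f assume f: "f \<in> carrier (galois_group L K)"
    then have Bf: "f \<in> Bij L" by (simp add: carrier_galois_group)
    have "inv_into L f (x + y) = inv_into L f x + inv_into L f y" if "x \<in> L" "y \<in> L" for x y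
      by (rule Bij_inv_into_lemma[of L f "(+)"]) (use f that cl in \<open>auto simp: carrier_galois_group\<close>)
    moreover have "inv_into L f (x * y) = inv_into L f x * inv_into L f y" if "x \<in> L" "y \<in> L" for x y
      by (rule Bij_inv_into_lemma[of L f "(*)"]) (use f that cl in \<open>auto simp: carrier_galois_group\<close>)
    moreover have "inv_into L f x = x" if "x \<in> K" for x
      using f that assms(2) by (intro inv_into_f_eq) (auto simp: carrier_galois_group Bij_def bij_betw_def)
    ultimately show "inv\<^bsub>BijGroup L\<^esub> f \<in> carrier (galois_group L K)"
      using cl assms(2) restrict_inv_into_Bij[OF Bf]
      by (auto simp: inv_BijGroup[OF Bf] carrier_galois_group)
  next
    fix f g assume fg: "f \<in> carrier (galois_group L K)" "g \<in> carrier (galois_group L K)"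
    then have B: "f \<in> Bij L" "g \<in> Bij L" by (simp_all add: carrier_galois_group)
    have "g x \<in> L" if "x \<in> L" for x using Bij_imp_funcset[OF B(2)] that by blast
    then have "compose L f g \<in> carrier (galois_group L K)"
      using fg cl assms(2) compose_Bij[OF B] by (auto simp: carrier_galois_group compose_def subset_iff)
    then show "f \<otimes>\<^bsub>BijGroup L\<^esub> g \<in> carrier (galois_group L K)"
      using B by (simp add: BijGroup_def)
  qed
  then have "group (BijGroup L\<lparr>carrier := carrier (galois_group L K)\<rparr>)"
    by (rule subgroup.subgroup_is_group) (rule group_BijGroup)
  then show ?thesis by (simp add: galois_group_def)
qed

lemma one_galois_group: "\<one>\<^bsub>galois_group L K\<^esub> = (\<lambda>x\<in>L. x)"
  by (simp add: galois_group_def BijGroup_def)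

lemma mult_abs_galois:
  "g \<in> carrier (abs_galois K) \<Longrightarrow> h \<in> carrier (abs_galois K) \<Longrightarrow> (g \<otimes>\<^bsub>abs_galois K\<^esub> h) x = g (h x)"
  by (simp add: galois_group_def BijGroup_def compose_def)

lemma group_abs_galois: "group (abs_galois K)"
  by (rule group_galois_group) (auto simp: is_subfield_def)

lemma topspace_abs_krull: "topspace (abs_krull K) = carrier (abs_galois K)"
  by (simp add: krull_topology_def)

lemma continuous_map_abs_krull_eval: "continuous_map (abs_krull K) (discrete_topology UNIV) (\<lambda>h. h x)"
  unfolding krull_topology_def
  by (intro continuous_map_from_subtopology continuous_map_product_coordinates) simp

text \<open>The topology is that of pointwise convergence, so continuity is tested at each element x
  of the field.\<close>

lemma continuous_map_abs_krull:
  assumes "\<And>h. h \<in> carrier (abs_galois K) \<Longrightarrow> f h \<in> carrier (abs_galois K)"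
    and "\<And>x. continuous_map (abs_krull K) (discrete_topology UNIV) (\<lambda>h. f h x)"
  shows "continuous_map (abs_krull K) (abs_krull K) f"
proof -
  have "continuous_map (abs_krull K) (product_topology (\<lambda>_. discrete_topology UNIV) UNIV) f"
    using assms(2) by (simp add: continuous_map_componentwise_UNIV)
  then show ?thesis
    using assms(1)
    by (subst (2) krull_topology_def) (auto simp: continuous_map_in_subtopology topspace_abs_krull)
qed

section \<open>A quadratic extension inside the separable closure\<close>

locale quadratic_extension = separable_closure F for F :: "'s::field set" +
  fixes E :: "'s set" and a \<alpha> :: 's
  assumes two: "(2::'s) \<noteq> 0"
    and a: "a \<in> F - {0}" "a \<notin> (\<lambda>b. b\<^sup>2) ` (F - {0})"
    and \<alpha>: "\<alpha>\<^sup>2 = a"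
    and E: "E = is_subfield hull (insert \<alpha> F)"
begin

abbreviation "G \<equiv> abs_galois F"

lemma \<alpha>_nonzero: "\<alpha> \<noteq> 0"
  using a \<alpha> by auto

lemma \<alpha>_notin: "\<alpha> \<notin> F"
proof
  assume "\<alpha> \<in> F"
  then have "\<alpha>\<^sup>2 \<in> (\<lambda>b. b\<^sup>2) ` (F - {0})" using \<alpha>_nonzero by (intro imageI) simp
  then show False using a(2) \<alpha> by simp
qed

lemma \<alpha>_neq: "\<alpha> \<noteq> - \<alpha>"
proof
  assume "\<alpha> = - \<alpha>"
  then have "\<alpha> + \<alpha> = 0" by (simp only: eq_neg_iff_add_eq_0)
  then show False using two \<alpha>_nonzero by (simp flip: mult_2)
qed

lemma subfield_E: "is_subfield E"
  unfolding E by (rule hull_in) (auto simp: is_subfield_def)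

lemma E_supset: "F \<subseteq> E" "\<alpha> \<in> E"
  unfolding E by (auto intro: hull_inc)

lemma E_minimal: "is_subfield K \<Longrightarrow> F \<subseteq> K \<Longrightarrow> \<alpha> \<in> K \<Longrightarrow> E \<subseteq> K"
  unfolding E by (rule hull_minimal) auto

lemma G_hom:
  assumes "g \<in> carrier G"
  shows "g (x + y) = g x + g y" "g (x * y) = g x * g y" "x \<in> F \<Longrightarrow> g x = x" "g 0 = 0" "g 1 = 1"
    "g (- x) = - g x" "g (inverse x) = inverse (g x)"
proof -
  show add: "g (x + y) = g x + g y" and mult: "g (x * y) = g x * g y" and F: "x \<in> F \<Longrightarrow> g x = x" for x y
    using assms by (simp_all add: carrier_abs_galois)
  show 0: "g 0 = 0" and 1: "g 1 = 1" using F F_closed by auto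
  show "g (- x) = - g x"
    using add[of x "- x"] 0 by (simp add: eq_neg_iff_add_eq_0 add.commute)
  show "g (inverse x) = inverse (g x)"
  proof (cases "x = 0")
    case False
    then have "g x * g (inverse x) = 1" using mult[of x "inverse x"] 1 by simp
    then show ?thesis by (rule inverse_unique[symmetric])
  qed (simp add: 0)
qed

lemma G_\<alpha>: "g \<in> carrier G \<Longrightarrow> g \<alpha> = \<alpha> \<or> g \<alpha> = - \<alpha>"
proof -
  assume g: "g \<in> carrier G"
  have "(g \<alpha>)\<^sup>2 = g (\<alpha>\<^sup>2)" by (simp add: power2_eq_square G_hom[OF g])
  also have "\<dots> = \<alpha>\<^sup>2" using a \<alpha> G_hom(3)[OF g] by simp
  finally show ?thesis by (simp add: power2_eq_iff)
qed

text \<open>The fixed points of g form a subfield containing F; once it contains \<alpha> it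
  contains E by minimality.\<close>

lemma mem_abs_galois_E: "g \<in> carrier (abs_galois E) \<longleftrightarrow> g \<in> carrier G \<and> g \<alpha> = \<alpha>"
proof
  assume "g \<in> carrier (abs_galois E)"
  then show "g \<in> carrier G \<and> g \<alpha> = \<alpha>" using E_supset by (auto simp: carrier_abs_galois)
next
  assume g: "g \<in> carrier G \<and> g \<alpha> = \<alpha>"
  then have gG: "g \<in> carrier G" by simp
  have "E \<subseteq> {x. g x = x}"
    by (rule E_minimal) (use g G_hom[OF gG] in \<open>auto simp: is_subfield_def\<close>)
  then show "g \<in> carrier (abs_galois E)" using g by (auto simp: carrier_abs_galois)
qed

lemma conjugation_exists:
  obtains \<tau> where "\<tau> \<in> carrier G" "\<tau> \<alpha> = - \<alpha>"
proof -
  \<comment> \<open>The graph of x + y \<alpha> -> x - y \<alpha> on F + F \<alpha>. It is closed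
    under products because \<alpha>^2 is in F, and single-valued because \<alpha> is not.\<close>
  let ?R = "{(x + y * \<alpha>, x - y * \<alpha>) |x y. x \<in> F \<and> y \<in> F}"
  have RI: "(x + y * \<alpha>, x - y * \<alpha>) \<in> ?R" if "x \<in> F" "y \<in> F" for x y using that by blast
  have aF: "\<alpha> * \<alpha> \<in> F" using a \<alpha> by (simp add: power2_eq_square)
  have "partial_hom F ?R"
  proof (rule partial_homI)
    show "(c, c) \<in> ?R" if "c \<in> F" for c using RI[OF that F_closed(1)] by simp
    fix u v u' v' assume "(u, v) \<in> ?R" "(u', v') \<in> ?R"
    then obtain x y x' y' where F: "x \<in> F" "y \<in> F" "x' \<in> F" "y' \<in> F"
      and eq: "u = x + y * \<alpha>" "v = x - y * \<alpha>" "u' = x' + y' * \<alpha>" "v' = x' - y' * \<alpha>" by blast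
    have "(u + u', v + v') = ((x + x') + (y + y') * \<alpha>, (x + x') - (y + y') * \<alpha>)"
      by (simp add: eq algebra_simps)
    moreover have "(u * u', v * v') = ((x * x' + y * y' * (\<alpha> * \<alpha>)) + (x * y' + y * x') * \<alpha>,
        (x * x' + y * y' * (\<alpha> * \<alpha>)) - (x * y' + y * x') * \<alpha>)"
      by (simp add: eq algebra_simps)
    ultimately show "(u + u', v + v') \<in> ?R" "(u * u', v * v') \<in> ?R"
      using RI F aF F_closed by presburger+
  next
    fix v assume "(0, v) \<in> ?R"
    then obtain x y where xy: "x \<in> F" "y \<in> F" "x + y * \<alpha> = 0" "v = x - y * \<alpha>" by auto
    have "y = 0"
    proof (rule ccontr)
      assume "y \<noteq> 0"
      moreover have "y * \<alpha> = - x" using xy(3) by (simp add: eq_neg_iff_add_eq_0 add.commute)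
      ultimately have "\<alpha> = inverse y * (- x)" by (metis left_inverse mult.assoc mult_1)
      then have "\<alpha> \<in> F" using xy(1,2) F_closed by simp
      then show False using \<alpha>_notin by simp
    qed
    with xy show "v = 0" by simp
  qed
  then obtain \<tau> where \<tau>: "\<tau> \<in> carrier G" "\<forall>u v. (u, v) \<in> ?R \<longrightarrow> \<tau> u = v"
    by (rule extend_automorphism)
  have "\<tau> \<alpha> = - \<alpha>" using \<tau>(2)[rule_format, OF RI[OF F_closed(1,2)]] by simp
  with \<tau>(1) show ?thesis by (rule that)
qed

lemma lift_exists:
  assumes \<sigma>: "\<sigma> \<in> carrier (galois_group E F)"
  shows "\<exists>g. g \<in> carrier G \<and> restrict g E = \<sigma>"
proof -
  let ?R = "{(x, \<sigma> x) |x. x \<in> E}"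
  note cl = is_subfield_closed[OF subfield_E]
  have "partial_hom F ?R"
  proof (rule partial_homI)
    fix c assume "c \<in> F" then show "(c, c) \<in> ?R"
      using \<sigma> E_supset by (auto simp: carrier_galois_group)
  next
    fix y assume "(0, y) \<in> ?R" then show "y = 0"
      using \<sigma> F_closed by (auto simp: carrier_galois_group)
  qed (use \<sigma> cl in \<open>auto simp: carrier_galois_group\<close>)
  then obtain g where g: "g \<in> carrier G" "\<forall>x y. (x, y) \<in> ?R \<longrightarrow> g x = y"
    by (rule extend_automorphism)
  have "\<sigma> \<in> extensional E" using \<sigma> by (simp add: carrier_galois_group Bij_def)
  then have "restrict g E = \<sigma>"
    using g(2) by (intro extensionalityI[of _ E]) auto
  with g(1) show ?thesis by blast
qed

lemma restrict_mem_galois_group: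
  assumes g: "g \<in> carrier G"
  shows "restrict g E \<in> carrier (galois_group E F)"
proof -
  note cl = is_subfield_closed[OF subfield_E]
  have "E \<subseteq> {x. g x \<in> E}"
    by (rule E_minimal) (use G_\<alpha>[OF g] G_hom[OF g] cl E_supset in \<open>auto simp: is_subfield_def\<close>)
  \<comment> \<open>Surjectivity onto E also comes from minimality: the image of E is a subfield
    containing F and, as g \<alpha> is \<alpha> or - \<alpha>, also \<alpha>.\<close>
  moreover have "E \<subseteq> g ` E"
  proof (rule E_minimal)
    have "0 \<in> g ` E" "1 \<in> g ` E"
      using imageI[OF cl(1), of g] imageI[OF cl(2), of g] by (simp_all only: G_hom[OF g])
    moreover have "g x + g y \<in> g ` E" "g x * g y \<in> g ` E" "- g x \<in> g ` E" "inverse (g x) \<in> g ` E"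
      if "x \<in> E" "y \<in> E" for x y
      unfolding G_hom[OF g, symmetric] by (intro imageI cl that)+
    ultimately show "is_subfield (g ` E)" by (simp add: is_subfield_def)
    show "F \<subseteq> g ` E"
    proof
      fix x assume "x \<in> F"
      then show "x \<in> g ` E" using G_hom(3)[OF g] E_supset by (intro image_eqI[of _ _ x]) auto
    qed
    have "\<alpha> = g \<alpha> \<or> \<alpha> = g (- \<alpha>)" using G_\<alpha>[OF g] G_hom[OF g] by auto
    then show "\<alpha> \<in> g ` E" using E_supset cl by blast
  qed
  moreover have "inj g" using g by (simp add: carrier_abs_galois bij_def)
  ultimately have "bij_betw g E E" unfolding bij_betw_def using inj_on_subset by blast
  then have "restrict g E \<in> Bij E" by (simp add: Bij_def)
  then show ?thesis using cl G_hom[OF g] E_supset by (auto simp: carrier_galois_group)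
qed

text \<open>Here the generator hypothesis enters: were the lift trivial on E, sigma would be the
  identity and the Galois group trivial, yet some automorphism sends \<alpha> to - \<alpha>.\<close>

lemma galois_lift:
  assumes \<sigma>: "\<sigma> \<in> carrier (galois_group E F)"
    and gen: "generate (galois_group E F) {\<sigma>} = carrier (galois_group E F)"
  shows "galois_lift E F \<sigma> \<in> carrier G" "galois_lift E F \<sigma> \<notin> carrier (abs_galois E)"
proof -
  let ?g = "galois_lift E F \<sigma>"
  have g: "?g \<in> carrier G" "restrict ?g E = \<sigma>"
    using someI_ex[OF lift_exists[OF \<sigma>]] unfolding galois_lift_def by auto
  then show "?g \<in> carrier G" by simp
  interpret Gal: group "galois_group E F"
    by (rule group_galois_group[OF subfield_E E_supset(1)])
  show "?g \<notin> carrier (abs_galois E)"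
  proof
    assume "?g \<in> carrier (abs_galois E)"
    then have "restrict ?g E = (\<lambda>x\<in>E. x)" by (intro restrict_ext) (simp add: carrier_abs_galois)
    then have "\<sigma> = \<one>\<^bsub>galois_group E F\<^esub>" using g(2) by (simp add: one_galois_group)
    then have triv: "carrier (galois_group E F) = {\<lambda>x\<in>E. x}"
      using gen Gal.generate_one by (simp add: one_galois_group)
    obtain \<tau> where \<tau>: "\<tau> \<in> carrier G" "\<tau> \<alpha> = - \<alpha>" by (rule conjugation_exists)
    have "restrict \<tau> E = (\<lambda>x\<in>E. x)" using restrict_mem_galois_group[OF \<tau>(1)] triv by blast
    then have "restrict \<tau> E \<alpha> = (\<lambda>x\<in>E. x) \<alpha>" by simp
    then show False using \<tau>(2) E_supset \<alpha>_neq by simp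
  qed
qed

lemma open_index_two_abs_galois: "open_index_two G (abs_krull F) (carrier (abs_galois E))"
proof -
  interpret G: group G by (rule group_abs_galois)
  show ?thesis
  proof (intro open_index_two.intro open_index_two_axioms.intro group_abs_galois)
    show "topspace (abs_krull F) = carrier G" by (rule topspace_abs_krull)
    fix g assume g: "g \<in> carrier G"
    have "continuous_map (abs_krull F) (discrete_topology UNIV) (\<lambda>h. (g \<otimes>\<^bsub>G\<^esub> h) x)" for x
    proof (rule continuous_map_eq)
      show "continuous_map (abs_krull F) (discrete_topology UNIV) (g \<circ> (\<lambda>h. h x))"
        by (rule continuous_map_compose[OF continuous_map_abs_krull_eval]) simp
    qed (use g in \<open>simp add: topspace_abs_krull mult_abs_galois\<close>)
    with g show "continuous_map (abs_krull F) (abs_krull F) (\<lambda>h. g \<otimes>\<^bsub>G\<^esub> h)"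
      by (intro continuous_map_abs_krull) simp_all
    have "continuous_map (abs_krull F) (discrete_topology UNIV) (\<lambda>h. (h \<otimes>\<^bsub>G\<^esub> g) x)" for x
      by (rule continuous_map_eq[OF continuous_map_abs_krull_eval[of F "g x"]])
        (use g in \<open>simp add: topspace_abs_krull mult_abs_galois\<close>)
    with g show "continuous_map (abs_krull F) (abs_krull F) (\<lambda>h. h \<otimes>\<^bsub>G\<^esub> g)"
      by (intro continuous_map_abs_krull) simp_all
  next
    show "subgroup (carrier (abs_galois E)) G"
    proof (rule G.subgroupI)
      show "carrier (abs_galois E) \<subseteq> carrier G" by (auto simp: mem_abs_galois_E)
      have "\<one>\<^bsub>G\<^esub> \<in> carrier (abs_galois E)"
        using G.one_closed by (simp add: mem_abs_galois_E one_galois_group)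
      then show "carrier (abs_galois E) \<noteq> {}" by blast
      fix g assume g: "g \<in> carrier (abs_galois E)"
      then have gG: "g \<in> carrier G" "g \<alpha> = \<alpha>" by (simp_all add: mem_abs_galois_E)
      have "(inv\<^bsub>G\<^esub> g) (g \<alpha>) = (inv\<^bsub>G\<^esub> g \<otimes>\<^bsub>G\<^esub> g) \<alpha>"
        by (rule mult_abs_galois[symmetric]) (use gG in simp_all)
      also have "\<dots> = \<alpha>" by (simp add: G.l_inv[OF gG(1)] one_galois_group)
      finally show "inv\<^bsub>G\<^esub> g \<in> carrier (abs_galois E)" using gG by (simp add: mem_abs_galois_E)
      fix h assume "h \<in> carrier (abs_galois E)"
      with g show "g \<otimes>\<^bsub>G\<^esub> h \<in> carrier (abs_galois E)" by (simp add: mem_abs_galois_E mult_abs_galois)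
    qed
  next
    \<comment> \<open>Evaluation at \<alpha> is continuous into a discrete space, and the subgroup
      is the preimage of a point; this makes it and its complement open.\<close>
    have preimage: "openin (abs_krull F) {g \<in> topspace (abs_krull F). g \<alpha> \<in> U}" for U
      by (rule openin_continuous_map_preimage[OF continuous_map_abs_krull_eval]) simp
    have "{g \<in> topspace (abs_krull F). g \<alpha> \<in> {\<alpha>}} = carrier (abs_galois E)"
      by (auto simp: topspace_abs_krull mem_abs_galois_E)
    then show "openin (abs_krull F) (carrier (abs_galois E))"
      using preimage[of "{\<alpha>}"] by (simp only:)
    have "{g \<in> topspace (abs_krull F). g \<alpha> \<in> - {\<alpha>}} = carrier G - carrier (abs_galois E)"
      by (auto simp: topspace_abs_krull mem_abs_galois_E)
    then show "openin (abs_krull F) (carrier G - carrier (abs_galois E))"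
      using preimage[of "- {\<alpha>}"] by (simp only:)
  next
    \<comment> \<open>Each automorphism multiplies \<alpha> by a sign, and the signs multiply under
      composition.\<close>
    fix g h assume gh: "g \<in> carrier G" "h \<in> carrier G"
    then show "g \<otimes>\<^bsub>G\<^esub> h \<in> carrier (abs_galois E) \<longleftrightarrow>
        (g \<in> carrier (abs_galois E) \<longleftrightarrow> h \<in> carrier (abs_galois E))"
      using G_\<alpha>[OF gh(1)] G_\<alpha>[OF gh(2)] G_hom(6)[OF gh(1), of \<alpha>] \<alpha>_neq
      by (auto simp: mem_abs_galois_E mult_abs_galois)
  next
    obtain \<tau> where "\<tau> \<in> carrier G" "\<tau> \<alpha> = - \<alpha>" by (rule conjugation_exists)
    then show "carrier (abs_galois E) \<noteq> carrier G" using \<alpha>_neq mem_abs_galois_E by metis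
  qed
qed

lemma abs_galois_E: "abs_galois E = G\<lparr>carrier := carrier (abs_galois E)\<rparr>"
  by (simp add: galois_group_def)

text \<open>Both topologies are induced from pointwise convergence on the whole separable closure,
  so they are compatible.\<close>

lemma abs_krull_E: "abs_krull E = subtopology (abs_krull F) (carrier (abs_galois E))"
proof -
  have "carrier G \<inter> carrier (abs_galois E) = carrier (abs_galois E)"
    by (auto simp: mem_abs_galois_E)
  then show ?thesis by (simp add: krull_topology_def subtopology_subtopology)
qed

text \<open>The root picked in the Kummer class is \<alpha> or - \<alpha>, and the sign cancels in
  the quotient. So the Kummer character of \<open>a\<close> is the character of G with kernel the
  absolute Galois group of E.\<close>

lemma kummer_hom_eq:
  assumes g: "g \<in> carrier G"
  shows "kummer_hom a g = of_bool (g \<notin> carrier (abs_galois E))"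
proof -
  define \<beta> where "\<beta> = (SOME \<beta>. \<beta>\<^sup>2 = a)"
  have "\<beta>\<^sup>2 = \<alpha>\<^sup>2" unfolding \<beta>_def \<alpha> using \<alpha> by (rule someI)
  then have \<beta>: "\<beta> = \<alpha> \<or> \<beta> = - \<alpha>" by (simp add: power2_eq_iff)
  then have "g \<beta> / \<beta> = 1 \<longleftrightarrow> g \<alpha> = \<alpha>" using \<alpha>_nonzero G_hom(6)[OF g, of \<alpha>] by auto
  then show ?thesis using g by (simp add: kummer_hom_def \<beta>_def[symmetric] mem_abs_galois_E)
qed

end

theorem theorem1:
  fixes F E :: "'s::field set" and a \<alpha> \<zeta> :: 's and \<sigma> :: "'s \<Rightarrow> 's" and n :: nat
  assumes "separably_closes F"
    and "\<zeta> \<in> F" and "\<zeta>\<^sup>2 = 1" and "\<zeta> \<noteq> 1"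
    and "a \<in> F - {0}" and "a \<notin> (\<lambda>b. b\<^sup>2) ` (F - {0})"
    and "\<alpha>\<^sup>2 = a" and "E = is_subfield hull (insert \<alpha> F)"
    and "\<sigma> \<in> carrier (galois_group E F)"
    and "generate (galois_group E F) {\<sigma>} = carrier (galois_group E F)"
    and "n \<ge> 1"
  shows "kernel (HF2 E n) (HF2 F n) (cores E F n)
           = (\<lambda>c. galois_act E F n \<sigma> c \<otimes>\<^bsub>HF2 E n\<^esub> inv\<^bsub>HF2 E n\<^esub> c) ` carrier (HF2 E n)
         \<longleftrightarrow>
         carrier (HF2 F n)
           = cores E F n ` carrier (HF2 E n)
             <#>\<^bsub>HF2 F n\<^esub> cup_HF2 F 1 (n - 1) (kummer_class F a) ` carrier (HF2 F (n - 1))"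
proof -
  have "(2::'s) \<noteq> 0"
  proof
    assume two: "(2::'s) = 0"
    \<comment> \<open>In characteristic 2 this would give \<zeta> = 1, so the primitive root of
      unity forces 2 to be nonzero and \<alpha> to differ from - \<alpha>.\<close>
    have "(\<zeta> - 1)\<^sup>2 = 2 * (1 - \<zeta>)" using assms(3) by (simp add: power2_eq_square algebra_simps)
    with two assms(4) show False by simp
  qed
  then interpret quadratic_extension F E a \<alpha>
    by unfold_locales (use assms in auto)
  interpret open_index_two G "abs_krull F" "carrier (abs_galois E)"
    by (rule open_index_two_abs_galois)
  obtain m where n: "n = Suc m" using assms(11) by (cases n) auto
  let ?g = "galois_lift E F \<sigma>"
  have HE: "HF2 E k = cohomology GH TH k" for k
    unfolding HF2_def abs_krull_E by (subst abs_galois_E) simp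
  have HF: "HF2 F k = cohomology G (abs_krull F) k" for k
    by (rule HF2_def)
  have cores: "cores E F k = cor_class k" for k
    by (rule ext) (simp only: cores_def cor_class_def flip: abs_galois_E)
  have act: "galois_act E F k \<sigma> = conj_class k ?g" for k
    by (rule ext) (simp only: galois_act_def conj_class_def flip: abs_galois_E abs_krull_E)
  have "(\<lambda>x. if x \<in> points G 1 then kummer_hom a (inv\<^bsub>G\<^esub> (x 0) \<otimes>\<^bsub>G\<^esub> x 1) else 0) = kummer_cocycle"
  proof
    fix x
    show "(if x \<in> points G 1 then kummer_hom a (inv\<^bsub>G\<^esub> (x 0) \<otimes>\<^bsub>G\<^esub> x 1) else 0) = kummer_cocycle x"
    proof (cases "x \<in> points G 1")
      case True
      then have "x 0 \<in> carrier G" "x 1 \<in> carrier G" by auto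
      then have "inv\<^bsub>G\<^esub> (x 0) \<otimes>\<^bsub>G\<^esub> x 1 \<in> carrier G" by simp
      then show ?thesis unfolding kummer_cocycle_def by (simp only: kummer_hom_eq)
    qed (simp add: kummer_cocycle_def)
  qed
  then have "kummer_class F a = cohomology_class G (abs_krull F) 1 kummer_cocycle"
    by (simp only: kummer_class_def)
  then show ?thesis
    using kernel_cor_class_iff[OF galois_lift[OF assms(9,10)], of m]
    by (simp only: n HE HF cores act cup_HF2_def diff_Suc_1)
qed

end
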